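(* Let $G$ be a cubic graph with base embedding $\widehat{\Pi}$, and let $\Pi$ be an embedding of $G$ with unstable dual $G^*_\Pi$. Suppose that $G^*_\Pi=\phi(G_1,G_2)$ for zero-homologous graphs $G_1$ and $G_2$; that is, $G^*_\Pi$ is the union of zero-homologous subgraphs $G_1,G_2$ of $G^*$ which have exactly two vertices $u\ne v$ in common and no edges in common, and the edges of $G_1$ appear consecutively in the local rotation of $G^*_\Pi$ at each of $u$ and $v$. Then there exist embeddings $\Pi_1$ and $\Pi_2$ of $G$ such that $G^*_{\Pi_i}$ is isomorphic to (indeed is) the graph $G_i$, for $i=1,2$. In addition, with $U^\phi_i$, $V^\phi_i$ $(i=1,2)$ and $s_{\Pi_i}$ as defined in the context, $$\Delta g(\Pi)=\Delta g(\Pi_1)+\Delta g(\Pi_2)-s_{\Pi_1}(U^\phi_1,V^\phi_1)\,s_{\Pi_2}(U^\phi_2,V^\phi_2).$$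
   Context: $G$ is a finite connected graph. All embeddings are 2-cell embeddings in closed orientable surfaces and are described by rotation systems: an embedding $\Pi$ assigns to each vertex $v$ a clockwise cyclic ordering $\pi_v$ of the edges incident with $v$. $g(\Pi)$ is the genus of the surface of $\Pi$. Fix a base embedding $\widehat{\Pi}$ with local rotations $\widehat{\pi}_v$. A vertex $v$ is $\Pi$-unstable if $\pi_v\neq\widehat{\pi}_v$; an edge is $\Pi$-unstable if exactly one of its endpoints is $\Pi$-unstable, and $\Pi$-stable otherwise; a face of $\widehat{\Pi}$ is $\Pi$-unstable if its boundary contains at least one $\Pi$-unstable edge. Let $G^*$ be the dual graph of $G$ with respect to $\widehat{\Pi}$, embedded in the same surface as $\widehat{\Pi}$. The $\Pi$-unstable dual $G^*_\Pi$ is the subgraph of $G^*$ whose vertices are the $\Pi$-unstable faces and whose edges are the dual edges of the $\Pi$-unstable edges; its local rotation at a vertex is the cyclic order of its edges inherited from the embedded graph $G^*$. A subgraph $H^*$ of $G^*$ is zero-homologous if its edges separate the surface into two parts $A\cup B$ with $\partial A=\partial B=E(H^* )$; equivalently, $E(H^* )$ is the mod-2 sum of the boundaries of some set of faces of $G^*$. $\Delta g(\Pi)=g(\Pi)-g(\widehat{\Pi})$. Stable subwalks. For an embedding $\Pi$, the $\Pi$-unstable edges on the boundary walk of a $\Pi$-unstable face $u$ of $\widehat{\Pi}$ cut that walk into segments between cyclically consecutive $\Pi$-unstable edges; these (consisting only of stable edges) are the stable subwalks of $u$ with respect to $\Pi$. Each facial walk of $\Pi$ is a cyclic sequence of stable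 subwalks (of faces of $\widehat{\Pi}$, possibly reversed) separated by $\Pi$-unstable edges. For a stable subwalk $U$ of a face $u$ and a stable subwalk $V$ of a face $v$, put $s_\Pi(U,V)=1$ if $U$ and $V$ belong to the same $\Pi$-facial walk, and $s_\Pi(U,V)=0$ otherwise. The subwalks $U^\phi_i,V^\phi_i$. Here $u$ and $v$ are the two common vertices of $G_1$ and $G_2$, viewed as faces of $\widehat{\Pi}$. $U^\phi_1$ is the stable subwalk of the face $u$ with respect to $\Pi_1$ that contains the edges of $G$ whose dual edges are the edges of $G_2$ incident with $u$; $U^\phi_2$ is the stable subwalk of the face $u$ with respect to $\Pi_2$ that contains the edges of $G$ whose dual edges are the edges of $G_1$ incident with $u$. $V^\phi_1$ and $V^\phi_2$ are defined in the same way with $v$ in place of $u$. *)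

theory Defs
  imports
    "HOL.Rat"
    "HOL-Combinatorics.Orbits"
    "Graph_Theory.Graph_Theory"
begin

text \<open>
  An undirected multigraph (loops and parallel edges allowed) is a bidirected digraph
  \<open>G\<close> with arc reversal \<open>\<iota>\<close>: an edge is a pair \<open>{a, \<iota> a}\<close> of mutually reverse arcs, and
  \<open>out_arcs G v\<close> is the set of edge-ends at \<open>v\<close>, so a loop has two ends at its vertex.
  A rotation system is a single permutation \<open>\<sigma>\<close> of the arcs; the local rotation at \<open>v\<close> is its
  restriction to \<open>out_arcs G v\<close>.
\<close>

definition cubic :: "('a, 'b) pre_digraph \<Rightarrow> bool" where
  "cubic G \<longleftrightarrow> (\<forall>v \<in> verts G. out_degree G v = 3)"

definition rotation_system :: "('a, 'b) pre_digraph \<Rightarrow> ('b \<Rightarrow> 'b) \<Rightarrow> bool" where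
  "rotation_system G \<sigma> \<longleftrightarrow>
     \<sigma> permutes arcs G \<and>
     (\<forall>v \<in> verts G. out_arcs G v \<noteq> {} \<longrightarrow> cyclic_on \<sigma> (out_arcs G v))"


subsection \<open>Facial walks and genus\<close>

text \<open>
  Face tracing: after traversing \<open>a\<close>, leave its head along the arc following \<open>\<iota> a\<close> in the
  local rotation there. A facial walk is identified with the set of arcs it traverses, an
  orbit of \<open>face_succ\<close>; every arc lies on exactly one facial walk.
\<close>

definition face_succ :: "('b \<Rightarrow> 'b) \<Rightarrow> ('b \<Rightarrow> 'b) \<Rightarrow> 'b \<Rightarrow> 'b" where
  "face_succ \<iota> \<sigma> a = \<sigma> (\<iota> a)"

definition face_of :: "('b \<Rightarrow> 'b) \<Rightarrow> ('b \<Rightarrow> 'b) \<Rightarrow> 'b \<Rightarrow> 'b set" where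
  "face_of \<iota> \<sigma> a = orbit (face_succ \<iota> \<sigma>) a"

definition faces :: "('a, 'b) pre_digraph \<Rightarrow> ('b \<Rightarrow> 'b) \<Rightarrow> ('b \<Rightarrow> 'b) \<Rightarrow> 'b set set" where
  "faces G \<iota> \<sigma> = face_of \<iota> \<sigma> ` arcs G"

definition edges :: "('a, 'b) pre_digraph \<Rightarrow> ('b \<Rightarrow> 'b) \<Rightarrow> 'b set set" where
  "edges G \<iota> = (\<lambda>a. {a, \<iota> a}) ` arcs G"

definition euler_char :: "('a, 'b) pre_digraph \<Rightarrow> ('b \<Rightarrow> 'b) \<Rightarrow> ('b \<Rightarrow> 'b) \<Rightarrow> int" where
  "euler_char G \<iota> \<sigma> =
     int (card (verts G)) - int (card (edges G \<iota>)) + int (card (faces G \<iota> \<sigma>))"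

text \<open>
  For a connected graph with at least one edge the surface has Euler characteristic
  \<open>2 - 2 * genus\<close>. The value is an integer; taking it in the rationals avoids truncating division.
\<close>

definition genus :: "('a, 'b) pre_digraph \<Rightarrow> ('b \<Rightarrow> 'b) \<Rightarrow> ('b \<Rightarrow> 'b) \<Rightarrow> rat" where
  "genus G \<iota> \<sigma> = of_int (2 - euler_char G \<iota> \<sigma>) / 2"

definition genus_diff ::
    "('a, 'b) pre_digraph \<Rightarrow> ('b \<Rightarrow> 'b) \<Rightarrow> ('b \<Rightarrow> 'b) \<Rightarrow> ('b \<Rightarrow> 'b) \<Rightarrow> rat" where
  "genus_diff G \<iota> \<sigma>\<^sub>0 \<sigma> = genus G \<iota> \<sigma> - genus G \<iota> \<sigma>\<^sub>0"


subsection \<open>The dual graph and the unstable dual\<close>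

text \<open>
  The dual edge of \<open>{a, \<iota> a}\<close> is represented by the same two arcs: in the dual, \<open>a\<close> leads from
  the face whose boundary walk traverses \<open>a\<close> to the face whose boundary walk traverses \<open>\<iota> a\<close>.
  The arcs leaving a face are thus the arcs of its boundary walk, and the rotation system of
  the dual embedding is \<open>face_succ \<iota> \<sigma>\<close>.
\<close>

definition dual :: "('a, 'b) pre_digraph \<Rightarrow> ('b \<Rightarrow> 'b) \<Rightarrow> ('b \<Rightarrow> 'b) \<Rightarrow> ('b set, 'b) pre_digraph" where
  "dual G \<iota> \<sigma> =
     \<lparr> verts = faces G \<iota> \<sigma>, arcs = arcs G,
       tail = face_of \<iota> \<sigma>, head = (\<lambda>a. face_of \<iota> \<sigma> (\<iota> a)) \<rparr>"

text \<open>Below, \<open>\<sigma>\<^sub>0\<close> is the base embedding and \<open>\<sigma>\<close> the embedding compared with it.\<close>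

definition unstable_vert ::
    "('a, 'b) pre_digraph \<Rightarrow> ('b \<Rightarrow> 'b) \<Rightarrow> ('b \<Rightarrow> 'b) \<Rightarrow> 'a \<Rightarrow> bool" where
  "unstable_vert G \<sigma>\<^sub>0 \<sigma> v \<longleftrightarrow> (\<exists>a \<in> out_arcs G v. \<sigma> a \<noteq> \<sigma>\<^sub>0 a)"

definition unstable_arcs :: "('a, 'b) pre_digraph \<Rightarrow> ('b \<Rightarrow> 'b) \<Rightarrow> ('b \<Rightarrow> 'b) \<Rightarrow> 'b set" where
  "unstable_arcs G \<sigma>\<^sub>0 \<sigma> =
     {a \<in> arcs G. unstable_vert G \<sigma>\<^sub>0 \<sigma> (tail G a) \<noteq> unstable_vert G \<sigma>\<^sub>0 \<sigma> (head G a)}"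

definition unstable_faces ::
    "('a, 'b) pre_digraph \<Rightarrow> ('b \<Rightarrow> 'b) \<Rightarrow> ('b \<Rightarrow> 'b) \<Rightarrow> ('b \<Rightarrow> 'b) \<Rightarrow> 'b set set" where
  "unstable_faces G \<iota> \<sigma>\<^sub>0 \<sigma> = {F \<in> faces G \<iota> \<sigma>\<^sub>0. F \<inter> unstable_arcs G \<sigma>\<^sub>0 \<sigma> \<noteq> {}}"

definition unstable_dual ::
    "('a, 'b) pre_digraph \<Rightarrow> ('b \<Rightarrow> 'b) \<Rightarrow> ('b \<Rightarrow> 'b) \<Rightarrow> ('b \<Rightarrow> 'b) \<Rightarrow> ('b set, 'b) pre_digraph" where
  "unstable_dual G \<iota> \<sigma>\<^sub>0 \<sigma> =
     \<lparr> verts = unstable_faces G \<iota> \<sigma>\<^sub>0 \<sigma>, arcs = unstable_arcs G \<sigma>\<^sub>0 \<sigma>,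
       tail = tail (dual G \<iota> \<sigma>\<^sub>0), head = head (dual G \<iota> \<sigma>\<^sub>0) \<rparr>"


subsection \<open>Zero-homologous subgraphs and the operation phi\<close>

text \<open>
  \<open>D\<close> is a graph embedded by the rotation system \<open>\<rho>\<close>. The boundary of a face \<open>F\<close> is taken mod 2:
  it consists of the edges \<open>{a, \<iota> a}\<close> traversed exactly once by \<open>F\<close>.
\<close>

definition zero_homologous ::
    "('a, 'b) pre_digraph \<Rightarrow> ('b \<Rightarrow> 'b) \<Rightarrow> ('b \<Rightarrow> 'b) \<Rightarrow> ('a, 'b) pre_digraph \<Rightarrow> bool" where
  "zero_homologous D \<iota> \<rho> H \<longleftrightarrow>
     (\<exists>S \<subseteq> faces D \<iota> \<rho>.
        arcs H = {a \<in> arcs D. odd (card {F \<in> S. (a \<in> F) \<noteq> (\<iota> a \<in> F)})})"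

text \<open>The cyclic order on a set \<open>B\<close> of edge-ends at a vertex inherited from the rotation \<open>\<rho>\<close>.\<close>

definition inherited_rotation :: "('b \<Rightarrow> 'b) \<Rightarrow> 'b set \<Rightarrow> 'b \<Rightarrow> 'b" where
  "inherited_rotation \<rho> B a = (\<rho> ^^ (LEAST n. 0 < n \<and> (\<rho> ^^ n) a \<in> B)) a"

definition consecutive :: "('b \<Rightarrow> 'b) \<Rightarrow> 'b set \<Rightarrow> bool" where
  "consecutive \<rho> C \<longleftrightarrow> (\<exists>a n. C = {(\<rho> ^^ k) a | k. k < n})"

text \<open>
  \<open>H = \<phi>(G\<^sub>1, G\<^sub>2)\<close> with common vertices \<open>u\<close> and \<open>v\<close>, inside the graph \<open>D\<close> embedded by \<open>\<rho>\<close>.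
  That \<open>u\<close> and \<open>v\<close> are ends of edges of both \<open>G\<^sub>1\<close> and \<open>G\<^sub>2\<close> excludes isolated vertices,
  which zero-homology, a condition on edges, does not see.
\<close>

definition is_phi ::
    "('a, 'b) pre_digraph \<Rightarrow> ('b \<Rightarrow> 'b) \<Rightarrow> ('b \<Rightarrow> 'b) \<Rightarrow> ('a, 'b) pre_digraph \<Rightarrow>
     ('a, 'b) pre_digraph \<Rightarrow> ('a, 'b) pre_digraph \<Rightarrow> 'a \<Rightarrow> 'a \<Rightarrow> bool" where
  "is_phi D \<iota> \<rho> H G\<^sub>1 G\<^sub>2 u v \<longleftrightarrow>
     subgraph G\<^sub>1 D \<and> subgraph G\<^sub>2 D \<and>
     zero_homologous D \<iota> \<rho> G\<^sub>1 \<and> zero_homologous D \<iota> \<rho> G\<^sub>2 \<and>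
     H = union G\<^sub>1 G\<^sub>2 \<and>
     u \<noteq> v \<and> verts G\<^sub>1 \<inter> verts G\<^sub>2 = {u, v} \<and> arcs G\<^sub>1 \<inter> arcs G\<^sub>2 = {} \<and>
     (\<forall>w \<in> {u, v}. out_arcs G\<^sub>1 w \<noteq> {} \<and> out_arcs G\<^sub>2 w \<noteq> {} \<and>
        consecutive (inherited_rotation \<rho> (out_arcs H w)) (out_arcs G\<^sub>1 w))"


subsection \<open>Stable subwalks\<close>

definition facial_segment :: "('b \<Rightarrow> 'b) \<Rightarrow> ('b \<Rightarrow> 'b) \<Rightarrow> 'b list \<Rightarrow> bool" where
  "facial_segment \<iota> \<sigma> ws \<longleftrightarrow>
     (\<forall>i. Suc i < length ws \<longrightarrow> ws ! Suc i = face_succ \<iota> \<sigma> (ws ! i))"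

text \<open>
  A stable subwalk is stored together with the two unstable arcs delimiting it: the list
  \<open>[a\<^sub>0, a\<^sub>1, \<dots>, a\<^sub>k, a\<^sub>k\<^sub>+\<^sub>1]\<close> stands for the stable subwalk \<open>a\<^sub>1, \<dots>, a\<^sub>k\<close>. Without the delimiters
  one could not tell whether a facial walk of another embedding that traverses \<open>a\<^sub>1\<close>
  follows this subwalk or runs along the other side of the same edge.
\<close>

definition stable_subwalk ::
    "('a, 'b) pre_digraph \<Rightarrow> ('b \<Rightarrow> 'b) \<Rightarrow> ('b \<Rightarrow> 'b) \<Rightarrow> ('b \<Rightarrow> 'b) \<Rightarrow> 'b set \<Rightarrow> 'b list \<Rightarrow> bool" where
  "stable_subwalk G \<iota> \<sigma>\<^sub>0 \<sigma> F ws \<longleftrightarrow>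
     2 \<le> length ws \<and> set ws \<subseteq> F \<and> facial_segment \<iota> \<sigma>\<^sub>0 ws \<and>
     hd ws \<in> unstable_arcs G \<sigma>\<^sub>0 \<sigma> \<and> last ws \<in> unstable_arcs G \<sigma>\<^sub>0 \<sigma> \<and>
     set (butlast (tl ws)) \<inter> unstable_arcs G \<sigma>\<^sub>0 \<sigma> = {}"

definition subwalk_containing ::
    "('a, 'b) pre_digraph \<Rightarrow> ('b \<Rightarrow> 'b) \<Rightarrow> ('b \<Rightarrow> 'b) \<Rightarrow> ('b \<Rightarrow> 'b) \<Rightarrow> 'b set \<Rightarrow> 'b set \<Rightarrow> 'b list" where
  "subwalk_containing G \<iota> \<sigma>\<^sub>0 \<sigma> F B =
     (THE ws. stable_subwalk G \<iota> \<sigma>\<^sub>0 \<sigma> F ws \<and> B \<subseteq> set (butlast (tl ws)))"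

text \<open>
  A facial walk \<open>W\<close> of \<open>\<sigma>\<close> follows a subwalk in its own direction, or reversed (where the
  local rotations along the subwalk are the reversed ones).
\<close>

definition on_facial_walk ::
    "('b \<Rightarrow> 'b) \<Rightarrow> ('b \<Rightarrow> 'b) \<Rightarrow> 'b set \<Rightarrow> 'b list \<Rightarrow> bool" where
  "on_facial_walk \<iota> \<sigma> W ws \<longleftrightarrow>
     (\<exists>ws' \<in> {ws, rev (map \<iota> ws)}. set ws' \<subseteq> W \<and> facial_segment \<iota> \<sigma> ws')"

definition same_facial_walk ::
    "('a, 'b) pre_digraph \<Rightarrow> ('b \<Rightarrow> 'b) \<Rightarrow> ('b \<Rightarrow> 'b) \<Rightarrow> 'b list \<Rightarrow> 'b list \<Rightarrow> rat" where
  "same_facial_walk G \<iota> \<sigma> U V =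
     of_bool (\<exists>W \<in> faces G \<iota> \<sigma>. on_facial_walk \<iota> \<sigma> W U \<and> on_facial_walk \<iota> \<sigma> W V)"

end

theory Submission
  imports Defs
begin

text \<open>
  A cubic vertex has only two local rotations, so an embedding is determined by its set \<open>X\<close> of
  unstable vertices, and its unstable edges form the cut of \<open>X\<close>. If the cut of \<open>X\<close> is the disjoint
  union of the edge sets of \<open>G\<^sub>1\<close> and \<open>G\<^sub>2\<close>, and \<open>X\<^sub>2\<close> is a vertex set with cut \<open>G\<^sub>2\<close>, then the
  symmetric difference \<open>X\<^sub>1\<close> of \<open>X\<close> and \<open>X\<^sub>2\<close> has cut \<open>G\<^sub>1\<close>; flipping the base embedding at \<open>X\<^sub>1\<close>
  and at \<open>X\<^sub>2\<close> gives \<open>\<Pi>\<^sub>1\<close> and \<open>\<Pi>\<^sub>2\<close>.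

  Writing \<open>F\<close>, \<open>F\<^sub>0\<close>, \<open>F\<^sub>1\<close>, \<open>F\<^sub>2\<close> for the numbers of faces of the four embeddings, the genus formula
  says \<open>F + F\<^sub>0 = F\<^sub>1 + F\<^sub>2 + 2 s\<^sub>1 s\<^sub>2\<close>. Follow each facial walk in both directions along the two
  sides of the arcs: the four embeddings become products of one permutation of these flags with
  side-switching involutions supported on the cuts. The face cycles that meet both cuts are the two
  directions of \<open>u\<close> and of \<open>v\<close>; consecutiveness allows a transposition to cut each of them between
  its two stretches, after which the cycle counts are additive. Undoing the four transpositions
  loses four cycles in each embedding, except that in the one twisted by both cuts the last two
  of them gain a cycle each if \<open>u\<close> and \<open>v\<close> were already joined on both sides, that is, if
  \<open>s\<^sub>1 = s\<^sub>2 = 1\<close>.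
\<close>

subsection \<open>Cycles of permutations under multiplication by transpositions\<close>

lemma orbit_eq_iff:
  assumes "permutation f"
  shows "orbit f y = orbit f x \<longleftrightarrow> y \<in> orbit f x"
  by (metis assms cyclic_on_orbit' orbit_cyclic_eq3 permutation_self_in_orbit)

lemma orbit_sym:
  assumes "permutation f"
  shows "y \<in> orbit f x \<longleftrightarrow> x \<in> orbit f y"
  by (metis assms orbit_eq_iff)

lemma orbit_subset_closed:
  assumes "x \<in> A" "\<And>z. z \<in> A \<Longrightarrow> f z \<in> A"
  shows "orbit f x \<subseteq> A"
proof
  fix y assume "y \<in> orbit f x"
  then show "y \<in> A" by induct (auto simp: assms)
qed

lemma orbit_invariant:
  assumes "y \<in> orbit f x" "\<And>z. h (f z) = h z"
  shows "h y = h x"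
  using assms(1) by induct (auto simp: assms)

lemma funpow_in_orbit_if_agree:
  assumes "permutation g" "\<And>k. k < n \<Longrightarrow> g (e k) = e (Suc k)"
  shows "e n \<in> orbit g (e 0)"
  using assms(2)
proof (induction n)
  case 0
  then show ?case by (simp add: assms permutation_self_in_orbit)
next
  case (Suc n)
  then have "g (e n) = e (Suc n)" "e n \<in> orbit g (e 0)" by auto
  then show ?case by (metis orbit.step)
qed

lemma permutation_transpose_comp:
  assumes "permutation q"
  shows "permutation (q \<circ> transpose x y)"
  using assms by (simp add: permutation_compose permutation_swap_id)

text \<open>Precomposing with the transposition exchanges the successors of \<open>x\<close> and
  \<open>y\<close>, so a walk around one cycle passes into the other at the marked point and back
  again.\<close>

lemma orbit_transpose_merge:
  assumes q: "permutation q" and xy: "y \<notin> orbit q x"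
  shows "orbit (q \<circ> transpose x y) z =
    (if z \<in> orbit q x \<union> orbit q y then orbit q x \<union> orbit q y else orbit q z)"
proof -
  let ?q = "q \<circ> transpose x y"
  \<comment> \<open>From \<open>b\<close> the new permutation jumps to \<open>q a\<close> and then
    runs around the whole old cycle of \<open>a\<close>, which does not contain \<open>b\<close>;
    only at \<open>a\<close> itself would it deviate.\<close>
  have half: "orbit q a \<subseteq> orbit (q \<circ> transpose a b) b" if "b \<notin> orbit q a" for a b
  proof
    fix z assume "z \<in> orbit q a"
    then show "z \<in> orbit (q \<circ> transpose a b) b"
    proof induct
      case base
      show ?case by (metis comp_apply orbit.base transpose_apply_second)
    next
      case (step z)
      show ?case
      proof (cases "z = a")
        case True
        then show ?thesis by (metis comp_apply orbit.base transpose_apply_second)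
      next
        case False
        moreover have "z \<noteq> b" using step that by auto
        ultimately have "(q \<circ> transpose a b) z = q z" by simp
        then show ?thesis using step by (metis orbit.step)
      qed
    qed
  qed
  have self: "w \<in> orbit q w" "w \<in> orbit ?q w" for w
    by (rule permutation_self_in_orbit[OF q],
      rule permutation_self_in_orbit[OF permutation_transpose_comp[OF q]])
  have A: "orbit q x \<subseteq> orbit ?q y" using half[OF xy] .
  have B: "orbit q y \<subseteq> orbit ?q x"
    using half[of x y] xy orbit_sym[OF q] by (metis transpose_commute)
  have eq: "orbit ?q x = orbit ?q y"
    using A self orbit_eq_iff[OF permutation_transpose_comp[OF q]] by blast
  have cl: "?q w \<in> orbit q x \<union> orbit q y" if "w \<in> orbit q x \<union> orbit q y" for w
    using that by (cases "w = x"; cases "w = y") (auto intro: orbit.intros)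
  have U: "orbit ?q x = orbit q x \<union> orbit q y"
    using orbit_subset_closed[of x "orbit q x \<union> orbit q y" ?q] cl self A B eq by blast
  show ?thesis
  proof (cases "z \<in> orbit q x \<union> orbit q y")
    case True
    then show ?thesis using U A B eq
      by (metis orbit_eq_iff permutation_transpose_comp q)
  next
    case False
    have "orbit ?q z = orbit q z"
    proof (rule orbit_cong)
      show "z \<in> orbit q z" by (rule self)
      fix s assume "s \<in> orbit q z"
      then have "s \<noteq> x" "s \<noteq> y" using False orbit_sym[OF q] by blast+
      then show "?q s = q s" by simp
    qed
    then show ?thesis using False by simp
  qed
qed

lemma card_orbits_transpose_merge:
  assumes K: "finite K" "x \<in> K" "y \<in> K" and q: "permutation q" and xy: "y \<notin> orbit q x"
  shows "card (orbit (q \<circ> transpose x y) ` K) + 1 = card (orbit q ` K)"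
proof -
  let ?U = "orbit q x \<union> orbit q y"
  let ?R = "orbit q ` (K - ?U)"
  have self: "w \<in> orbit q w" for w using q by (rule permutation_self_in_orbit)
  have 1: "orbit (q \<circ> transpose x y) ` K = insert ?U ?R"
    using K self unfolding orbit_transpose_merge[OF q xy] by (auto simp: image_iff)
  have 2: "orbit q ` K = insert (orbit q x) (insert (orbit q y) ?R)"
  proof -
    have "orbit q z \<in> {orbit q x, orbit q y}" if "z \<in> ?U" for z
      using that orbit_eq_iff[OF q] by auto
    then show ?thesis using K by (auto simp: image_iff)
  qed
  have d: "A \<inter> ?U = {}" if "A \<in> ?R" for A
    using that by (auto dest: orbit_trans simp: orbit_sym[OF q])
  have "?U \<notin> ?R" "orbit q x \<notin> ?R" "orbit q y \<notin> ?R" "orbit q x \<noteq> orbit q y"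
    using d[of ?U] d[of "orbit q x"] d[of "orbit q y"] self[of x] self[of y] xy by blast+
  then show ?thesis unfolding 1 2 using K by simp
qed

text \<open>The new cycle of \<open>y\<close> jumps to \<open>q x\<close>, retraces the old cycle up
  to its first visit to \<open>y\<close> and closes there, without passing \<open>x\<close>.\<close>

lemma orbit_transpose_split:
  assumes q: "permutation q" and xy: "y \<in> orbit q x" "x \<noteq> y"
  shows "y \<notin> orbit (q \<circ> transpose x y) x"
proof -
  define P where "P n \<longleftrightarrow> 0 < n \<and> (q ^^ n) x = y" for n
  have ex: "\<exists>n. P n" using xy unfolding P_def orbit_altdef by auto
  define n where "n = (LEAST n. P n)"
  have n: "0 < n" "(q ^^ n) x = y" using LeastI_ex[OF ex] unfolding n_def P_def by auto
  have min: "(q ^^ k) x \<noteq> y" if "0 < k" "k < n" for k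
    using not_less_Least[of k P] that unfolding n_def P_def by auto
  \<comment> \<open>A return to \<open>x\<close> before step \<open>n\<close> would mean an earlier
    visit to \<open>y\<close>.\<close>
  have nx: "(q ^^ k) x \<noteq> x" if "0 < k" "k < n" for k
  proof
    assume "(q ^^ k) x = x"
    have "(q ^^ (n - k + k)) x = y" using n that by simp
    then have "(q ^^ (n - k)) ((q ^^ k) x) = y" by (simp only: funpow_add comp_apply)
    then have "(q ^^ (n - k)) x = y" using \<open>(q ^^ k) x = x\<close> by simp
    then show False using min[of "n - k"] that by simp
  qed
  let ?S = "{(q ^^ k) x | k. 0 < k \<and> k \<le> n}"
  have "orbit (q \<circ> transpose x y) y \<subseteq> ?S"
  proof (rule orbit_subset_closed)
    show "y \<in> ?S" using n by blast
    fix z assume "z \<in> ?S"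
    then obtain k where k: "0 < k" "k \<le> n" "z = (q ^^ k) x" by blast
    show "(q \<circ> transpose x y) z \<in> ?S"
    proof (cases "k = n")
      case True
      then have "(q \<circ> transpose x y) z = (q ^^ 1) x" using k n by simp
      then show ?thesis using n by (intro CollectI exI[of _ 1]) auto
    next
      case False
      then have "(q \<circ> transpose x y) z = (q ^^ Suc k) x" using k min[of k] nx[of k] by simp
      then show ?thesis using k False by (intro CollectI exI[of _ "Suc k"]) auto
    qed
  qed
  moreover have "x \<notin> ?S"
  proof
    assume "x \<in> ?S"
    then obtain k where "0 < k" "k \<le> n" "x = (q ^^ k) x" by blast
    then show False using nx[of k] n xy(2) by (cases "k = n") auto
  qed
  ultimately show ?thesis
    using orbit_sym[OF permutation_transpose_comp[OF q]] by blast
qed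

text \<open>Multiplying by the same transposition again restores \<open>q\<close>, so this is the
  merging count read backwards.\<close>

lemma card_orbits_transpose_split:
  assumes "finite K" "x \<in> K" "y \<in> K" and q: "permutation q" and xy: "y \<in> orbit q x" "x \<noteq> y"
  shows "card (orbit (q \<circ> transpose x y) ` K) = card (orbit q ` K) + 1"
  using card_orbits_transpose_merge[OF assms(1-3) permutation_transpose_comp[OF q]
    orbit_transpose_split[OF q xy]]
  by (simp add: comp_assoc)

text \<open>The first transposition merges the cycles of \<open>x\<close> and \<open>y\<close>. The
  second one splits exactly if \<open>z\<close> and \<open>w\<close> now share a cycle; by
  \<open>sep\<close> this needs \<open>z\<close> on the old cycle of \<open>x\<close> and
  \<open>w\<close> on that of \<open>y\<close>.\<close>

lemma card_orbits_two_transposes: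
  assumes K: "finite K" "x \<in> K" "y \<in> K" "z \<in> K" "w \<in> K" and q: "permutation q"
    and sep: "y \<notin> orbit q x" "w \<notin> orbit q x" "y \<notin> orbit q z" "w \<notin> orbit q z"
  shows "card (orbit (q \<circ> transpose x y \<circ> transpose z w) ` K) + 2 =
    card (orbit q ` K) + (if z \<in> orbit q x \<and> w \<in> orbit q y then 2 else 0)"
proof -
  let ?q = "q \<circ> transpose x y"
  have q': "permutation ?q" by (rule permutation_transpose_comp[OF q])
  have 1: "card (orbit ?q ` K) + 1 = card (orbit q ` K)"
    by (rule card_orbits_transpose_merge[OF K(1,2,3) q sep(1)])
  have zw: "z \<noteq> w" using sep(4) permutation_self_in_orbit[OF q] by blast
  have "w \<in> orbit ?q z \<longleftrightarrow> z \<in> orbit q x \<and> w \<in> orbit q y"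
    unfolding orbit_transpose_merge[OF q sep(1)] using sep orbit_sym[OF q] by auto
  then show ?thesis
    using 1 card_orbits_transpose_merge[OF K(1,4,5) q', of]
      card_orbits_transpose_split[OF K(1,4,5) q' _ zw]
    by (cases "w \<in> orbit ?q z") auto
qed

section \<open>Products with lists of transpositions\<close>

definition swaps :: "('k \<Rightarrow> 'k) \<Rightarrow> ('k \<times> 'k) list \<Rightarrow> 'k \<Rightarrow> 'k" where
  "swaps q L = foldl (\<lambda>q (x, y). q \<circ> transpose x y) q L"

lemma swaps_simps [simp]:
  "swaps q [] = q"
  "swaps q ((x, y) # L) = swaps (q \<circ> transpose x y) L"
  "swaps q (L @ [(x, y)]) = swaps q L \<circ> transpose x y"
  by (simp_all add: swaps_def)

lemma comp_swaps: "t \<circ> swaps q L = swaps (t \<circ> q) L"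
  by (induction L arbitrary: q) (auto simp: comp_assoc)

lemma swaps_rev: "swaps (swaps q L) (rev L) = q"
  by (induction L arbitrary: q) (auto simp: comp_assoc)

lemma swaps_flip: "swaps q (map prod.swap L) = swaps q L"
  by (induction L arbitrary: q) (auto simp: transpose_commute)

lemma swaps_permutes:
  assumes "q permutes K" "set L \<subseteq> K \<times> K"
  shows "swaps q L permutes K"
  using assms
proof (induction L arbitrary: q)
  case (Cons a L)
  obtain x y where a: "a = (x, y)" by fastforce
  have "q \<circ> transpose x y permutes K"
    using Cons.prems a by (auto intro!: permutes_compose permutes_swap_id)
  then show ?case using Cons a by simp
qed simp

lemma swaps_apply_other:
  assumes "z \<notin> fst ` set L" "z \<notin> snd ` set L"
  shows "swaps q L z = q z"
  using assms by (induction L arbitrary: q) (auto simp: transpose_def)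

lemma swaps_apply:
  assumes "distinct (map fst L @ map snd L)" "(x, y) \<in> set L"
  shows "swaps q L x = q y \<and> swaps q L y = q x"
  using assms
proof (induction L arbitrary: q)
  case (Cons a L)
  obtain x' y' where a: "a = (x', y')" by fastforce
  have new: "x' \<notin> fst ` set L" "x' \<notin> snd ` set L" "y' \<notin> fst ` set L" "y' \<notin> snd ` set L"
    and d: "distinct (map fst L @ map snd L)"
    using Cons.prems(1) unfolding a by simp_all
  show ?case
  proof (cases "(x, y) = a")
    case True
    then show ?thesis using new a by (simp add: swaps_apply_other)
  next
    case False
    then have xy: "(x, y) \<in> set L" using Cons.prems(2) by simp
    then have "x \<in> fst ` set L" "y \<in> snd ` set L" by (auto intro: rev_image_eqI)
    then have "x \<noteq> x'" "y \<noteq> x'" "x \<noteq> y'" "y \<noteq> y'" using new by metis+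
    then have "(q \<circ> transpose x' y') x = q x" "(q \<circ> transpose x' y') y = q y" by simp_all
    then show ?thesis using Cons.IH[OF d xy, of "q \<circ> transpose x' y'"]
      by (simp only: a swaps_simps)
  qed
qed auto

text \<open>Each pair hangs a further cycle, disjoint from \<open>C\<close>, onto a cycle through
  \<open>C\<close>. This loses one cycle and joins no points of \<open>C\<close> that were apart.
  The sortedness condition says that the hung cycles are distinct.\<close>

lemma pendant_swaps:
  assumes "finite K" "permutation q" "C \<subseteq> K" "set L \<subseteq> C \<times> K"
    and "\<And>x y. (x, y) \<in> set L \<Longrightarrow> orbit q y \<inter> C = {}"
    and "sorted_wrt (\<lambda>a b. snd b \<notin> orbit q (snd a)) L"
  shows "card (orbit (swaps q L) ` K) + length L = card (orbit q ` K) \<and>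
    (\<forall>a \<in> C. \<forall>b \<in> C. b \<in> orbit (swaps q L) a \<longleftrightarrow> b \<in> orbit q a)"
  using assms
proof (induction L arbitrary: q)
  case (Cons c L)
  obtain x y where c: "c = (x, y)" by fastforce
  have xy: "x \<in> C" "y \<in> K" "orbit q y \<inter> C = {}" using Cons.prems c by auto
  have q: "permutation q" by fact
  have self: "w \<in> orbit q w" for w using q by (rule permutation_self_in_orbit)
  have nxy: "y \<notin> orbit q x" using xy orbit_sym[OF q] by blast
  let ?q = "q \<circ> transpose x y"
  note m = orbit_transpose_merge[OF q nxy]
  \<comment> \<open>The merge at \<open>(x, y)\<close> does not reach the cycles hung on later, so
    the hypotheses carry over to the tail of the list.\<close>
  have o: "orbit ?q y' = orbit q y'" if y': "(x', y') \<in> set L" for x' y'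
  proof -
    have "x \<notin> orbit q y'" "y' \<notin> orbit q y" using Cons.prems(5,6) xy y' c by auto
    then show ?thesis unfolding m using orbit_sym[OF q] by auto
  qed
  have "card (orbit (swaps ?q L) ` K) + length L = card (orbit ?q ` K) \<and>
    (\<forall>a \<in> C. \<forall>b \<in> C. b \<in> orbit (swaps ?q L) a \<longleftrightarrow> b \<in> orbit ?q a)"
  proof (rule Cons.IH[OF Cons.prems(1) permutation_transpose_comp[OF q] Cons.prems(3)])
    show "set L \<subseteq> C \<times> K" using Cons.prems by auto
    show "orbit ?q y' \<inter> C = {}" if "(x', y') \<in> set L" for x' y'
      using o[OF that] Cons.prems(5) that by auto
    have "sorted_wrt (\<lambda>a b. snd b \<notin> orbit q (snd a)) L" using Cons.prems(6) by simp
    then show "sorted_wrt (\<lambda>a b. snd b \<notin> orbit ?q (snd a)) L"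
      by (rule sorted_wrt_mono_rel[rotated]) (metis o prod.collapse)
  qed
  moreover have "card (orbit ?q ` K) + 1 = card (orbit q ` K)"
    using card_orbits_transpose_merge[OF Cons.prems(1) _ xy(2) q nxy] xy Cons.prems(3) by auto
  moreover have "b \<in> orbit ?q a \<longleftrightarrow> b \<in> orbit q a" if "a \<in> C" "b \<in> C" for a b
  proof -
    have "a \<notin> orbit q y" "b \<notin> orbit q y" using xy that by auto
    then show ?thesis unfolding m using orbit_eq_iff[OF q] by auto
  qed
  ultimately show ?case using c by auto
qed auto

lemma card_orbits_Un:
  assumes "finite K1" "finite K2" "K1 \<inter> K2 = {}" "permutation q"
    "\<And>k. k \<in> K1 \<Longrightarrow> q k \<in> K1"
  shows "card (orbit q ` (K1 \<union> K2)) = card (orbit q ` K1) + card (orbit q ` K2)"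
proof -
  have "orbit q ` K1 \<inter> orbit q ` K2 = {}"
    using orbit_subset_closed[of _ K1 q] assms(3,5) permutation_self_in_orbit[OF assms(4)]
    by (fastforce simp: disjoint_iff)
  then show ?thesis using assms(1,2) by (simp add: image_Un card_Un_disjoint)
qed

text \<open>
  The four transpositions merge cycles of \<open>r\<close> inside \<open>K1\<close> with cycles inside \<open>K2\<close>. Each of them
  loses one cycle, except that after twisting by both \<open>t1\<close> and \<open>t2\<close> the second transposition of
  a pair splits a cycle again if its two ends were already joined on both sides.
\<close>

lemma card_orbits_glue:
  fixes r t1 t2 :: "'k \<Rightarrow> 'k" and Cls :: "'k \<Rightarrow> bool"
  assumes fin: "finite K1" "finite K2" and disj: "K1 \<inter> K2 = {}"
    and r: "r permutes K1 \<union> K2" and r1: "\<And>k. k \<in> K1 \<Longrightarrow> r k \<in> K1" and r2: "\<And>k. k \<in> K2 \<Longrightarrow> r k \<in> K2"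
    and t1: "t1 permutes K1" and t2: "t2 permutes K2"
    and x: "{x, z, x', z'} \<subseteq> K1" and y: "{y, w, y', w'} \<subseteq> K2"
    and dx: "distinct (map (orbit r) [x, z, x', z'])"
    and dy: "distinct (map (orbit r) [y, w, y', w'])"
    and Cls: "\<And>k. Cls (t1 (t2 (r k))) = Cls k"
    and Clsx: "Cls ` {x, z, y, w} = {c}" "Cls ` {x', z', y', w'} = {\<not> c}"
    and p: "p = swaps r [(x, y), (z, w), (x', y'), (z', w')]"
  defines "N \<equiv> \<lambda>q. card (orbit q ` (K1 \<union> K2))"
  shows "N (t1 \<circ> t2 \<circ> p) + N p = N (t1 \<circ> p) + N (t2 \<circ> p)
    + (if z \<in> orbit (t1 \<circ> p) x \<and> w \<in> orbit (t2 \<circ> p) y then 2 else 0)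
    + (if z' \<in> orbit (t1 \<circ> p) x' \<and> w' \<in> orbit (t2 \<circ> p) y' then 2 else 0)"
proof -
  let ?K = "K1 \<union> K2" and ?L = "[(x, y), (z, w), (x', y'), (z', w')]"
  let ?Q = "t1 \<circ> t2 \<circ> r"
  have finK: "finite ?K" using fin by simp
  have t1K: "t1 permutes ?K" and t2K: "t2 permutes ?K"
    using t1 t2 by (auto intro: permutes_subset)
  have perm: "permutation r" "permutation (t1 \<circ> r)" "permutation (t2 \<circ> r)" "permutation ?Q"
    using r t1K t2K finK by (auto intro!: permutation_compose intro: permutes_imp_permutation)
  have t1o: "t1 k = k" if "k \<in> K2" for k
    using t1 that disj by (auto simp: permutes_def)
  have t2o: "t2 k = k" if "k \<in> K1" for k
    using t2 that disj by (auto simp: permutes_def)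
  have t1i: "t1 k \<in> K1 \<longleftrightarrow> k \<in> K1" and t2i: "t2 k \<in> K2 \<longleftrightarrow> k \<in> K2" for k
    using t1 t2 by (simp_all add: permutes_in_image)
  \<comment> \<open>\<open>r\<close> respects both halves and each twist fixes the other half
    pointwise, so cycles in \<open>K1\<close> do not see \<open>t2\<close>, and cycles in
    \<open>K2\<close> do not see \<open>t1\<close>.\<close>
  have on1: "orbit (t2 \<circ> r) k = orbit r k" "orbit ?Q k = orbit (t1 \<circ> r) k"
      "orbit r k \<subseteq> K1" "orbit (t1 \<circ> r) k \<subseteq> K1" if k: "k \<in> K1" for k
  proof -
    show "orbit (t2 \<circ> r) k = orbit r k"
      by (rule orbit_cong0[OF k, symmetric]) (use r1 t2o in auto)
    show "orbit ?Q k = orbit (t1 \<circ> r) k"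
      by (rule orbit_cong0[OF k, symmetric]) (use r1 t2o t1i in auto)
    show "orbit r k \<subseteq> K1" by (rule orbit_subset_closed[OF k r1])
    show "orbit (t1 \<circ> r) k \<subseteq> K1" by (rule orbit_subset_closed[OF k]) (use r1 t1i in auto)
  qed
  have on2: "orbit (t1 \<circ> r) k = orbit r k" "orbit ?Q k = orbit (t2 \<circ> r) k"
      "orbit r k \<subseteq> K2" "orbit (t2 \<circ> r) k \<subseteq> K2" if k: "k \<in> K2" for k
  proof -
    show "orbit (t1 \<circ> r) k = orbit r k"
      by (rule orbit_cong0[OF k, symmetric]) (use r2 t1o in auto)
    show "orbit ?Q k = orbit (t2 \<circ> r) k"
      by (rule orbit_cong0[OF k, symmetric]) (use r2 t1o t2i in auto)
    show "orbit r k \<subseteq> K2" by (rule orbit_subset_closed[OF k r2])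
    show "orbit (t2 \<circ> r) k \<subseteq> K2" by (rule orbit_subset_closed[OF k]) (use r2 t2i in auto)
  qed
  have dis: "b \<notin> orbit r a" if "orbit r a \<noteq> orbit r b" for a b
    using that orbit_eq_iff[OF perm(1)] by metis
  have off: "orbit r b \<inter> K1 = {}" "orbit (t1 \<circ> r) b \<inter> K1 = {}" if "b \<in> K2" for b
    using on2(1,3)[OF that] disj by blast+
  have off': "orbit (t2 \<circ> r) b \<inter> K2 = {}" if "b \<in> K1" for b
    using on1(1,3)[OF that] disj by blast
  have Lx: "a \<in> K1" and Ly: "b \<in> K2" if "(a, b) \<in> set ?L" for a b
    using that x y by auto
  have L: "set ?L \<subseteq> K1 \<times> ?K" "set (map prod.swap ?L) \<subseteq> K2 \<times> ?K"
    using x y by auto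
  \<comment> \<open>With no twist, or with \<open>t1\<close> alone, the cycles through
    \<open>y\<close>, \<open>w\<close>, \<open>y'\<close>, \<open>w'\<close> are four distinct
    cycles of \<open>r\<close> inside \<open>K2\<close>, hence pendant over
    \<open>K1\<close>.\<close>
  have A: "N p + 4 = N r"
  proof -
    have "N (swaps r ?L) + length ?L = N r \<and>
      (\<forall>a \<in> K1. \<forall>b \<in> K1. b \<in> orbit (swaps r ?L) a \<longleftrightarrow> b \<in> orbit r a)"
      unfolding N_def
    proof (rule pendant_swaps[OF finK perm(1)])
      show "orbit r b \<inter> K1 = {}" if "(a, b) \<in> set ?L" for a b
        using off Ly that by blast
      show "sorted_wrt (\<lambda>a b. snd b \<notin> orbit r (snd a)) ?L" using dy dis by simp
    qed (use L in auto)
    then show ?thesis unfolding p by simp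
  qed
  have B: "N (t1 \<circ> p) + 4 = N (t1 \<circ> r)"
    "\<And>a b. a \<in> K1 \<Longrightarrow> b \<in> K1 \<Longrightarrow> b \<in> orbit (t1 \<circ> p) a \<longleftrightarrow> b \<in> orbit (t1 \<circ> r) a"
  proof -
    have "N (swaps (t1 \<circ> r) ?L) + length ?L = N (t1 \<circ> r) \<and>
      (\<forall>a \<in> K1. \<forall>b \<in> K1. b \<in> orbit (swaps (t1 \<circ> r) ?L) a \<longleftrightarrow> b \<in> orbit (t1 \<circ> r) a)"
      unfolding N_def
    proof (rule pendant_swaps[OF finK perm(2)])
      show "orbit (t1 \<circ> r) b \<inter> K1 = {}" if "(a, b) \<in> set ?L" for a b
        using off Ly that by blast
      show "sorted_wrt (\<lambda>a b. snd b \<notin> orbit (t1 \<circ> r) (snd a)) ?L" using dy dis on2(1) y by simp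
    qed (use L in auto)
    then show "N (t1 \<circ> p) + 4 = N (t1 \<circ> r)"
      "\<And>a b. a \<in> K1 \<Longrightarrow> b \<in> K1 \<Longrightarrow> b \<in> orbit (t1 \<circ> p) a \<longleftrightarrow> b \<in> orbit (t1 \<circ> r) a"
      unfolding p comp_swaps by simp_all
  qed
  have C: "N (t2 \<circ> p) + 4 = N (t2 \<circ> r)"
    "\<And>a b. a \<in> K2 \<Longrightarrow> b \<in> K2 \<Longrightarrow> b \<in> orbit (t2 \<circ> p) a \<longleftrightarrow> b \<in> orbit (t2 \<circ> r) a"
  proof -
    \<comment> \<open>With \<open>t2\<close> the halves change roles: turning each pair around keeps
      the product but makes \<open>K2\<close> the base half.\<close>
    let ?M = "map prod.swap ?L"
    have "N (swaps (t2 \<circ> r) ?M) + length ?M = N (t2 \<circ> r) \<and>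
      (\<forall>a \<in> K2. \<forall>b \<in> K2. b \<in> orbit (swaps (t2 \<circ> r) ?M) a \<longleftrightarrow> b \<in> orbit (t2 \<circ> r) a)"
      unfolding N_def
    proof (rule pendant_swaps[OF finK perm(3)])
      show "orbit (t2 \<circ> r) b \<inter> K2 = {}" if "(a, b) \<in> set ?M" for a b
        using off' Lx that by auto
      show "sorted_wrt (\<lambda>a b. snd b \<notin> orbit (t2 \<circ> r) (snd a)) ?M" using dx dis on1(1) x by simp
    qed (use L in auto)
    then show "N (t2 \<circ> p) + 4 = N (t2 \<circ> r)"
      "\<And>a b. a \<in> K2 \<Longrightarrow> b \<in> K2 \<Longrightarrow> b \<in> orbit (t2 \<circ> p) a \<longleftrightarrow> b \<in> orbit (t2 \<circ> r) a"
      unfolding p comp_swaps swaps_flip by simp_all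
  qed
  have sep: "b \<notin> orbit ?Q a" if "a \<in> K1" "b \<in> K2" for a b
    using on1[OF that(1)] that(2) disj by auto
  \<comment> \<open>With both twists present the ends may already share cycles on either half, so
    the transpositions are counted in two pairs.\<close>
  let ?Q2 = "?Q \<circ> transpose x y \<circ> transpose z w"
  have D: "N ?Q2 + 2 = N ?Q + (if z \<in> orbit ?Q x \<and> w \<in> orbit ?Q y then 2 else 0)"
    unfolding N_def
    by (rule card_orbits_two_transposes) (use x y finK perm sep in auto)
  \<comment> \<open>\<open>Cls\<close> is constant on cycles of \<open>?Q\<close>, and the first
    pair of transpositions touches only class \<open>c\<close>. The second pair, of the opposite
    class, therefore meets unchanged cycles.\<close>
  have same: "orbit ?Q2 k = orbit ?Q k" if "Cls k = (\<not> c)" for k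
  proof (rule orbit_cong)
    show "k \<in> orbit ?Q k" using perm(4) by (rule permutation_self_in_orbit)
    fix s assume "s \<in> orbit ?Q k"
    then have "Cls s = (\<not> c)" using orbit_invariant[of s ?Q k Cls] Cls that by simp
    then have "s \<notin> {x, z, y, w}" using Clsx(1) by blast
    then show "?Q2 s = ?Q s" by simp
  qed
  have cl': "Cls x' = (\<not> c)" "Cls y' = (\<not> c)" "Cls z' = (\<not> c)"
    using Clsx(2) by blast+
  have E: "N (?Q2 \<circ> transpose x' y' \<circ> transpose z' w') + 2 =
    N ?Q2 + (if z' \<in> orbit ?Q2 x' \<and> w' \<in> orbit ?Q2 y' then 2 else 0)"
    unfolding N_def
  proof (rule card_orbits_two_transposes)
    show "permutation ?Q2" using perm by (intro permutation_transpose_comp)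
  qed (use x y finK sep same cl' in auto)
  have F: "?Q2 \<circ> transpose x' y' \<circ> transpose z' w' = t1 \<circ> t2 \<circ> p"
    unfolding p comp_swaps by simp
  \<comment> \<open>Before gluing the counts are additive, since each half sees only its own
    twist.\<close>
  have G: "N ?Q + N r = N (t1 \<circ> r) + N (t2 \<circ> r)"
  proof -
    have "N q = card (orbit q ` K1) + card (orbit q ` K2)"
      if "q \<in> {r, t1 \<circ> r, t2 \<circ> r, ?Q}" for q
      unfolding N_def
    proof (rule card_orbits_Un[OF fin disj])
      show "permutation q" using that perm by auto
      show "q k \<in> K1" if "k \<in> K1" for k
        using \<open>q \<in> _\<close> r1[OF that] t1i t2o by auto
    qed
    moreover have "orbit ?Q ` K1 = orbit (t1 \<circ> r) ` K1" "orbit (t2 \<circ> r) ` K1 = orbit r ` K1"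
      using on1 by (auto intro!: image_cong)
    moreover have "orbit ?Q ` K2 = orbit (t2 \<circ> r) ` K2" "orbit (t1 \<circ> r) ` K2 = orbit r ` K2"
      using on2 by (auto intro!: image_cong)
    ultimately show ?thesis by simp
  qed
  have H: "(z \<in> orbit ?Q x \<longleftrightarrow> z \<in> orbit (t1 \<circ> p) x)" "(w \<in> orbit ?Q y \<longleftrightarrow> w \<in> orbit (t2 \<circ> p) y)"
    "(z' \<in> orbit ?Q2 x' \<longleftrightarrow> z' \<in> orbit (t1 \<circ> p) x')"
    "(w' \<in> orbit ?Q2 y' \<longleftrightarrow> w' \<in> orbit (t2 \<circ> p) y')"
    using same cl' B(2) C(2) x y on1 on2 by auto
  show ?thesis using A B(1) C(1) D E G unfolding H F by linarith
qed

subsection \<open>Embeddings of cubic graphs\<close>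

lemma cyclic_on_card_3:
  assumes f: "cyclic_on f S" and S: "card S = 3" and a: "a \<in> S"
  shows "f (f (f a)) = a" "f a \<noteq> a" "f (f a) \<noteq> a" "S = {a, f a, f (f a)}"
proof -
  have o: "orbit f b = S" if "b \<in> S" for b using f that by (rule orbit_cyclic_eq3)
  have small: "card (orbit f b) \<noteq> 3" if "f b = b \<or> f (f b) = b" for b
  proof -
    have "orbit f b \<subseteq> {b, f b}"
      by (rule orbit_subset_closed) (use that in auto)
    then have "card (orbit f b) \<le> card {b, f b}" by (intro card_mono) auto
    also have "\<dots> \<le> 2" by (simp add: card_insert_if)
    finally show ?thesis by simp
  qed
  have in_S: "f a \<in> S" "f (f a) \<in> S" "f (f (f a)) \<in> S"
    using a f by (auto intro: cyclic_on_inI)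
  have ne: "f b \<noteq> b" "f (f b) \<noteq> b" if "b \<in> S" for b
    using small[of b] o[OF that] S by auto
  show "f a \<noteq> a" "f (f a) \<noteq> a" using ne a by auto
  moreover have "f (f a) \<noteq> f a" using ne in_S by auto
  ultimately have "card {a, f a, f (f a)} = card S" using S by (simp add: card_insert_if)
  then show *: "S = {a, f a, f (f a)}"
    by (intro card_subset_eq[symmetric]) (use a in_S finite_cyclic_on[OF f] in auto)
  show "f (f (f a)) = a" using in_S(3) ne[OF in_S(1)] ne[OF in_S(2)] unfolding * by auto
qed

lemma cyclic_on_card_3_cases:
  assumes f: "cyclic_on f S" and g: "cyclic_on g S" and S: "card S = 3"
  shows "(\<forall>a \<in> S. g a = f a) \<or> (\<forall>a \<in> S. g a = f (f a))"
proof -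
  obtain a where a: "a \<in> S" using S by fastforce
  note fa = cyclic_on_card_3[OF f S a] and ga = cyclic_on_card_3[OF g S a]
  have eq: "{a, g a, g (g a)} = {a, f a, f (f a)}" using fa(4) ga(4) by simp
  have ne: "g (g a) \<noteq> g a" using cyclic_on_card_3(2)[OF g S] cyclic_on_inI[OF g a] by blast
  consider "g a = f a" | "g a = f (f a)" using eq ga(2) by blast
  then show ?thesis
  proof cases
    case 1
    then have "g (g a) = f (f a)" using eq ga(3) ne by (metis insert_iff singletonD)
    then have "\<forall>b \<in> {a, f a, f (f a)}. g b = f b" using 1 fa(1) ga(1) by auto
    then show ?thesis using fa(4) by blast
  next
    case 2
    then have "g (g a) = f a" using eq ga(3) ne by (metis insert_iff singletonD)
    then have "\<forall>b \<in> {a, f a, f (f a)}. g b = f (f b)" using 2 fa(1) ga(1) by auto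
    then show ?thesis using fa(4) by blast
  qed
qed

definition cut :: "('a, 'b) pre_digraph \<Rightarrow> ('a \<Rightarrow> bool) \<Rightarrow> 'b set" where
  "cut G Y = {a \<in> arcs G. Y (tail G a) \<noteq> Y (head G a)}"

text \<open>At a cubic vertex the only other local rotation is the inverse, which is the square.\<close>

definition flip :: "('a, 'b) pre_digraph \<Rightarrow> ('b \<Rightarrow> 'b) \<Rightarrow> ('a \<Rightarrow> bool) \<Rightarrow> 'b \<Rightarrow> 'b" where
  "flip G \<sigma> Y a = (if Y (tail G a) then \<sigma> (\<sigma> a) else \<sigma> a)"

text \<open>
  The flag \<open>(b, s)\<close> is the end of the arc \<open>b\<close> seen from its left side (\<open>s\<close> false) or its right
  side (\<open>s\<close> true). Facial walks of the base embedding keep to one side; facial walks of the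
  embedding flipped at \<open>Y\<close> change sides in the middle of every edge of \<open>cut G Y\<close>.
\<close>

definition flag_succ :: "('b \<Rightarrow> 'b) \<Rightarrow> ('b \<Rightarrow> 'b) \<Rightarrow> 'b \<times> bool \<Rightarrow> 'b \<times> bool" where
  "flag_succ \<iota> \<sigma> = (\<lambda>(b, s). (if s then \<sigma> (\<sigma> (\<iota> b)) else \<sigma> (\<iota> b), s))"

definition twist :: "'b set \<Rightarrow> 'b \<times> bool \<Rightarrow> 'b \<times> bool" where
  "twist D = (\<lambda>(b, s). (b, s \<noteq> (b \<in> D)))"

text \<open>Direction reversal. A flag sits at the head of its arc; along the reverse arc it lies on
  the opposite side, and running to the other end of that arc applies the twist.\<close>

definition rev_flag :: "('b \<Rightarrow> 'b) \<Rightarrow> 'b set \<Rightarrow> 'b \<times> bool \<Rightarrow> 'b \<times> bool" where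
  "rev_flag \<iota> D = (\<lambda>(b, s). twist D (\<iota> b, \<not> s))"

lemma twist_twist [simp]: "twist D (twist D k) = k"
  by (cases k) (auto simp: twist_def)

lemma twist_permutes:
  assumes "D \<times> UNIV \<subseteq> K"
  shows "twist D permutes K"
proof -
  have "twist D k = k" if "k \<notin> K" for k
    using that assms by (cases k) (auto simp: twist_def)
  moreover have "\<exists>!k. twist D k = k'" for k'
    by (metis twist_twist)
  ultimately show ?thesis by (simp add: permutes_def)
qed

locale cubic_map = fin_digraph G + bidirected_digraph G \<iota>
  for G :: "('a, 'b) pre_digraph" and \<iota> :: "'b \<Rightarrow> 'b" +
  fixes \<sigma>\<^sub>0 :: "'b \<Rightarrow> 'b"
  assumes cubic: "cubic G" and rotation: "rotation_system G \<sigma>\<^sub>0"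
begin

abbreviation \<phi> :: "'b \<Rightarrow> 'b" where
  "\<phi> \<equiv> face_succ \<iota> \<sigma>\<^sub>0"

abbreviation flags :: "('b \<times> bool) set" where
  "flags \<equiv> arcs G \<times> UNIV"

abbreviation walk :: "('a \<Rightarrow> bool) \<Rightarrow> 'b \<times> bool \<Rightarrow> 'b \<times> bool" where
  "walk Y \<equiv> twist (cut G Y) \<circ> flag_succ \<iota> \<sigma>\<^sub>0"

lemma card_out_arcs: "v \<in> verts G \<Longrightarrow> card (out_arcs G v) = 3"
  using cubic by (simp add: cubic_def out_degree_def)

lemma out_arcs_nonempty: "v \<in> verts G \<Longrightarrow> out_arcs G v \<noteq> {}"
  using card_out_arcs by fastforce

lemma cyclic_out_arcs:
  assumes "rotation_system G \<sigma>" "v \<in> verts G"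
  shows "cyclic_on \<sigma> (out_arcs G v)"
  using assms out_arcs_nonempty by (simp add: rotation_system_def)

lemma rotation_permutes: "\<sigma>\<^sub>0 permutes arcs G"
  using rotation by (simp add: rotation_system_def)

lemma rotation_arc [simp]:
  assumes "a \<in> arcs G"
  shows "\<sigma>\<^sub>0 a \<in> arcs G" "tail G (\<sigma>\<^sub>0 a) = tail G a" "\<sigma>\<^sub>0 a \<noteq> a" "\<sigma>\<^sub>0 (\<sigma>\<^sub>0 a) \<noteq> a"
proof -
  have c: "cyclic_on \<sigma>\<^sub>0 (out_arcs G (tail G a))" "card (out_arcs G (tail G a)) = 3"
    "a \<in> out_arcs G (tail G a)"
    using assms rotation by (auto intro!: cyclic_out_arcs card_out_arcs)
  show "\<sigma>\<^sub>0 a \<in> arcs G" "tail G (\<sigma>\<^sub>0 a) = tail G a"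
    using cyclic_on_inI[OF c(1,3)] by auto
  show "\<sigma>\<^sub>0 a \<noteq> a" "\<sigma>\<^sub>0 (\<sigma>\<^sub>0 a) \<noteq> a" by (rule cyclic_on_card_3[OF c])+
qed

lemma rotation_off: "a \<notin> arcs G \<Longrightarrow> \<sigma>\<^sub>0 a = a"
  using rotation_permutes by (simp add: permutes_def)

lemma rotation_3 [simp]: "\<sigma>\<^sub>0 (\<sigma>\<^sub>0 (\<sigma>\<^sub>0 a)) = a"
proof (cases "a \<in> arcs G")
  case True
  then have "cyclic_on \<sigma>\<^sub>0 (out_arcs G (tail G a))" "card (out_arcs G (tail G a)) = 3"
    using rotation by (auto intro!: cyclic_out_arcs card_out_arcs)
  then show ?thesis by (rule cyclic_on_card_3(1)) (use True in simp)
qed (simp add: rotation_off)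

lemma phi_arc [simp]:
  assumes "a \<in> arcs G"
  shows "\<phi> a \<in> arcs G" "tail G (\<phi> a) = head G a"
  using assms by (simp_all add: face_succ_def)

lemma face_succ_permutes:
  assumes "rotation_system G \<sigma>"
  shows "face_succ \<iota> \<sigma> permutes arcs G"
proof -
  have "face_succ \<iota> \<sigma> = \<sigma> \<circ> \<iota>" by (auto simp: face_succ_def)
  then show ?thesis
    using assms arev_permutes_arcs by (simp add: permutes_compose rotation_system_def)
qed

lemma permutation_face_succ: "rotation_system G \<sigma> \<Longrightarrow> permutation (face_succ \<iota> \<sigma>)"
  by (rule permutes_imp_permutation[OF finite_arcs face_succ_permutes])

lemma face_of_subset:
  assumes "rotation_system G \<sigma>" "a \<in> arcs G"
  shows "face_of \<iota> \<sigma> a \<subseteq> arcs G"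
  unfolding face_of_def using face_succ_permutes[OF assms(1)] assms(2) by (rule permutes_orbit_subset)

lemma flip_tail [simp]: "a \<in> arcs G \<Longrightarrow> tail G (flip G \<sigma>\<^sub>0 Y a) = tail G a"
  and flip_arc [simp]: "a \<in> arcs G \<Longrightarrow> flip G \<sigma>\<^sub>0 Y a \<in> arcs G"
  by (auto simp: flip_def)

text \<open>The square of a 3-cycle is a 3-cycle on the same set, and arcs with different tails
  cannot collide because tails are kept.\<close>

lemma rotation_system_flip: "rotation_system G (flip G \<sigma>\<^sub>0 Y)"
proof -
  let ?f = "flip G \<sigma>\<^sub>0 Y"
  have "inj_on ?f (arcs G)"
  proof (rule inj_onI)
    fix a b assume ab: "a \<in> arcs G" "b \<in> arcs G" "?f a = ?f b"
    then have "tail G a = tail G b" by (metis flip_tail)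
    then have "\<sigma>\<^sub>0 a = \<sigma>\<^sub>0 b \<or> \<sigma>\<^sub>0 (\<sigma>\<^sub>0 a) = \<sigma>\<^sub>0 (\<sigma>\<^sub>0 b)"
      using ab(3) by (auto simp: flip_def split: if_splits)
    then show "a = b" by (metis rotation_3)
  qed
  moreover from this have "?f ` arcs G = arcs G"
    by (intro endo_inj_surj) auto
  ultimately have "?f permutes arcs G"
    by (intro bij_imp_permutes) (auto simp: bij_betw_def flip_def rotation_off)
  moreover have "cyclic_on ?f (out_arcs G v)" if v: "v \<in> verts G" for v
  proof (cases "Y v")
    case False
    then have "cyclic_on ?f (out_arcs G v) = cyclic_on \<sigma>\<^sub>0 (out_arcs G v)"
      by (intro cyclic_cong) (auto simp: flip_def)
    then show ?thesis using cyclic_out_arcs[OF rotation v] by simp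
  next
    case True
    obtain a where a: "a \<in> out_arcs G v" using out_arcs_nonempty[OF v] by blast
    have S: "out_arcs G v = {a, \<sigma>\<^sub>0 a, \<sigma>\<^sub>0 (\<sigma>\<^sub>0 a)}"
      by (rule cyclic_on_card_3(4)[OF cyclic_out_arcs[OF rotation v] card_out_arcs[OF v] a])
    have f: "?f a = \<sigma>\<^sub>0 (\<sigma>\<^sub>0 a)" "?f (\<sigma>\<^sub>0 (\<sigma>\<^sub>0 a)) = \<sigma>\<^sub>0 a" "?f (\<sigma>\<^sub>0 a) = a"
      using a True by (auto simp: flip_def)
    have "orbit ?f a = {a, \<sigma>\<^sub>0 a, \<sigma>\<^sub>0 (\<sigma>\<^sub>0 a)}"
    proof
      show "orbit ?f a \<subseteq> {a, \<sigma>\<^sub>0 a, \<sigma>\<^sub>0 (\<sigma>\<^sub>0 a)}"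
        by (rule orbit_subset_closed) (use f in auto)
      show "{a, \<sigma>\<^sub>0 a, \<sigma>\<^sub>0 (\<sigma>\<^sub>0 a)} \<subseteq> orbit ?f a"
        using f by (metis empty_subsetI insert_subset orbit.base orbit.step)
    qed
    then show ?thesis using S a by (auto intro: cyclic_on_singleI)
  qed
  ultimately show ?thesis by (simp add: rotation_system_def)
qed

lemma unstable_vert_flip: "v \<in> verts G \<Longrightarrow> unstable_vert G \<sigma>\<^sub>0 (flip G \<sigma>\<^sub>0 Y) v = Y v"
  using out_arcs_nonempty[of v] by (auto simp: unstable_vert_def flip_def)

lemma unstable_arcs_flip: "unstable_arcs G \<sigma>\<^sub>0 (flip G \<sigma>\<^sub>0 Y) = cut G Y"
  by (auto simp: unstable_arcs_def cut_def unstable_vert_flip)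

lemma flip_unstable_vert:
  assumes \<sigma>: "rotation_system G \<sigma>"
  shows "flip G \<sigma>\<^sub>0 (unstable_vert G \<sigma>\<^sub>0 \<sigma>) = \<sigma>"
proof
  fix a
  show "flip G \<sigma>\<^sub>0 (unstable_vert G \<sigma>\<^sub>0 \<sigma>) a = \<sigma> a"
  proof (cases "a \<in> arcs G")
    case True
    let ?v = "tail G a"
    have v: "?v \<in> verts G" using True by simp
    have "(\<forall>a \<in> out_arcs G ?v. \<sigma> a = \<sigma>\<^sub>0 a) \<or> (\<forall>a \<in> out_arcs G ?v. \<sigma> a = \<sigma>\<^sub>0 (\<sigma>\<^sub>0 a))"
      using cyclic_out_arcs[OF rotation v] cyclic_out_arcs[OF \<sigma> v] card_out_arcs[OF v]
      by (rule cyclic_on_card_3_cases)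
    moreover have "\<sigma>\<^sub>0 (\<sigma>\<^sub>0 a) \<noteq> \<sigma>\<^sub>0 a" if "a \<in> arcs G" for a using that by simp
    ultimately show ?thesis using True
      by (auto simp: flip_def unstable_vert_def)
  next
    case False
    then have "\<sigma> a = a" using \<sigma> by (simp add: rotation_system_def permutes_def)
    then show ?thesis using False by (simp add: flip_def rotation_off)
  qed
qed

lemma cut_arc: "a \<in> cut G Y \<Longrightarrow> a \<in> arcs G"
  by (simp add: cut_def)

lemma cut_rev [simp]: "\<iota> a \<in> cut G Y \<longleftrightarrow> a \<in> cut G Y"
proof (cases "a \<in> arcs G")
  case True
  then show ?thesis by (auto simp: cut_def)
next
  case False
  then show ?thesis by (simp add: arev_eq)
qed

section \<open>Facial walks as cycles of flags\<close>

lemma flag_succ_permutes: "flag_succ \<iota> \<sigma>\<^sub>0 permutes flags"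
proof -
  have "flag_succ \<iota> \<sigma>\<^sub>0 k = k" if "k \<notin> flags" for k
    using that by (cases k) (auto simp: flag_succ_def rotation_off arev_eq)
  moreover have "\<exists>!k. flag_succ \<iota> \<sigma>\<^sub>0 k = k'" for k'
  proof (rule ex1I)
    \<comment> \<open>The inverse step: local rotations have order three, so the rotation and its
      square are inverse to each other.\<close>
    let ?k = "(\<iota> (if snd k' then \<sigma>\<^sub>0 (fst k') else \<sigma>\<^sub>0 (\<sigma>\<^sub>0 (fst k'))), snd k')"
    show "flag_succ \<iota> \<sigma>\<^sub>0 ?k = k'" by (cases k') (simp add: flag_succ_def)
    fix k assume "flag_succ \<iota> \<sigma>\<^sub>0 k = k'"
    then show "k = ?k" by (cases k) (auto simp: flag_succ_def)
  qed
  ultimately show ?thesis by (simp add: permutes_def)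
qed

lemma walk_permutes: "walk Y permutes flags"
  by (intro permutes_compose flag_succ_permutes twist_permutes) (auto simp: cut_def)

lemma finite_flags: "finite flags"
  by simp

lemma permutation_walk: "permutation (walk Y)"
  using walk_permutes finite_flags by (rule permutes_imp_permutation[rotated])

text \<open>At a flipped head the rotation runs backwards, which is what a flag on the right side
  does. Placing each arc on the side given by \<open>Y\<close> at its head thus turns face tracing
  into \<open>walk Y\<close>.\<close>

lemma walk_arc:
  assumes "b \<in> arcs G"
  shows "walk Y (b, Y (head G b)) =
    (face_succ \<iota> (flip G \<sigma>\<^sub>0 Y) b, Y (head G (face_succ \<iota> (flip G \<sigma>\<^sub>0 Y) b)))"
  using assms by (auto simp: flag_succ_def twist_def flip_def cut_def face_succ_def)

lemma orbit_walk:
  assumes "b \<in> arcs G"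
  shows "orbit (walk Y) (b, Y (head G b)) =
    (\<lambda>a. (a, Y (head G a))) ` face_of \<iota> (flip G \<sigma>\<^sub>0 Y) b"
  unfolding face_of_def
proof (rule orbit_inverse[symmetric])
  show "b \<in> orbit (face_succ \<iota> (flip G \<sigma>\<^sub>0 Y)) b"
    by (intro permutation_self_in_orbit permutation_face_succ rotation_system_flip)
  fix x assume "x \<in> orbit (face_succ \<iota> (flip G \<sigma>\<^sub>0 Y)) b"
  then have "x \<in> arcs G"
    using face_of_subset[OF rotation_system_flip assms, of Y] unfolding face_of_def by blast
  then show "walk Y (x, Y (head G x)) =
    (face_succ \<iota> (flip G \<sigma>\<^sub>0 Y) x, Y (head G (face_succ \<iota> (flip G \<sigma>\<^sub>0 Y) x)))"
    by (rule walk_arc)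
qed

lemma rev_flag_rev_flag [simp]:
  "rev_flag \<iota> (cut G Y) (rev_flag \<iota> (cut G Y) k) = k"
  by (cases k) (auto simp: rev_flag_def twist_def)

text \<open>Reversal conjugates the walk into its inverse, written here without the inverse
  permutation.\<close>

lemma walk_rev_flag_walk: "walk Y (rev_flag \<iota> (cut G Y) (walk Y k)) = rev_flag \<iota> (cut G Y) k"
  by (cases k) (auto simp: rev_flag_def twist_def flag_succ_def)

lemma orbit_walk_rev_flag:
  "rev_flag \<iota> (cut G Y) z \<in> orbit (walk Y) (rev_flag \<iota> (cut G Y) k) \<longleftrightarrow> z \<in> orbit (walk Y) k"
proof -
  let ?R = "rev_flag \<iota> (cut G Y)"
  have pred: "x \<in> orbit (walk Y) y" if "walk Y x \<in> orbit (walk Y) y" for x y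
    using that orbit_eq_iff[OF permutation_walk] permutation_orbit_step[OF permutation_walk]
    by metis
  have "?R z \<in> orbit (walk Y) (?R k)" if "z \<in> orbit (walk Y) k" for z k
    using that
  proof induct
    case base
    show ?case
      by (rule pred) (simp only: walk_rev_flag_walk permutation_self_in_orbit[OF permutation_walk])
  next
    case (step z)
    show ?case by (rule pred) (simp only: walk_rev_flag_walk step)
  qed
  then show ?thesis by (metis rev_flag_rev_flag)
qed

lemma orbit_walk_rev_flag_image:
  "orbit (walk Y) (rev_flag \<iota> (cut G Y) k) = rev_flag \<iota> (cut G Y) ` orbit (walk Y) k"
  by (auto simp: image_iff) (metis orbit_walk_rev_flag rev_flag_rev_flag)+

text \<open>Aligned flags are those that come from arcs of the embedding flipped at
  \<open>Y\<close>; the remaining flags are their reversals.\<close>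

definition aligned :: "('a \<Rightarrow> bool) \<Rightarrow> 'b \<times> bool \<Rightarrow> bool" where
  "aligned Y k \<longleftrightarrow> (snd k \<longleftrightarrow> Y (head G (fst k)))"

lemma aligned_walk:
  assumes "k \<in> flags"
  shows "aligned Y (walk Y k) = aligned Y k"
  using assms by (cases k) (auto simp: aligned_def twist_def flag_succ_def cut_def)

lemma aligned_orbit:
  assumes "z \<in> orbit (walk Y) k" "k \<in> flags"
  shows "aligned Y z = aligned Y k"
proof -
  have "z \<in> flags \<and> aligned Y z = aligned Y k"
    using assms(1)
  proof induct
    case base
    show ?case using assms(2) walk_permutes[of Y] aligned_walk permutes_in_image by metis
  next
    case (step z)
    then show ?case using walk_permutes[of Y] aligned_walk permutes_in_image by metis
  qed
  then show ?thesis by simp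
qed

text \<open>Every facial walk appears among the flag cycles twice, once in each direction.\<close>

lemma card_walk_orbits:
  "card (orbit (walk Y) ` flags) = 2 * card (faces G \<iota> (flip G \<sigma>\<^sub>0 Y))"
proof -
  let ?R = "rev_flag \<iota> (cut G Y)" and ?j = "\<lambda>a. (a, Y (head G a))"
  let ?F = "faces G \<iota> (flip G \<sigma>\<^sub>0 Y)"
  have j: "orbit (walk Y) ` ?j ` arcs G = image ?j ` ?F"
    by (simp add: faces_def image_image orbit_walk)
  have al: "aligned Y k \<longleftrightarrow> k \<in> ?j ` arcs G" if "k \<in> flags" for k
    using that by (cases k) (auto simp: aligned_def)
  have Rf: "?R k \<in> flags" "aligned Y (?R k) = (\<not> aligned Y k)" if "k \<in> flags" for k
    using that by (cases k; auto simp: aligned_def rev_flag_def twist_def cut_def)+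
  \<comment> \<open>Reversal exchanges aligned and unaligned flags, so the flag cycles fall into two
    disjoint families with one member per face each.\<close>
  have "flags = ?j ` arcs G \<union> ?R ` ?j ` arcs G"
  proof
    show "?j ` arcs G \<union> ?R ` ?j ` arcs G \<subseteq> flags" using Rf by blast
    show "flags \<subseteq> ?j ` arcs G \<union> ?R ` ?j ` arcs G"
    proof
      fix k assume k: "k \<in> flags"
      show "k \<in> ?j ` arcs G \<union> ?R ` ?j ` arcs G"
      proof (cases "aligned Y k")
        case False
        then have "?R k \<in> ?j ` arcs G" using al[OF Rf(1)[OF k]] Rf(2)[OF k] by blast
        then have "?R (?R k) \<in> ?R ` ?j ` arcs G" by (rule imageI)
        then show ?thesis by simp
      qed (use al k in blast)
    qed
  qed
  then have "orbit (walk Y) ` flags = image ?j ` ?F \<union> image ?R ` image ?j ` ?F"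
    by (simp add: image_Un j[symmetric] image_image orbit_walk_rev_flag_image)
  moreover have "image ?j ` ?F \<inter> image ?R ` image ?j ` ?F = {}"
  proof -
    have sub: "f \<subseteq> arcs G" if "f \<in> ?F" for f
      using that face_of_subset[OF rotation_system_flip] by (auto simp: faces_def)
    have al1: "aligned Y z" if "z \<in> A" "A \<in> image ?j ` ?F" for z A
      using that by (auto simp: aligned_def)
    have al2: "\<not> aligned Y z" if "z \<in> A" "A \<in> image ?R ` image ?j ` ?F" for z A
    proof -
      obtain f a where "f \<in> ?F" "a \<in> f" "z = ?R (?j a)" using \<open>z \<in> A\<close> \<open>A \<in> _\<close> by blast
      then show ?thesis using sub Rf(2)[of "?j a"] by (auto simp: aligned_def)
    qed
    have ne: "{} \<notin> image ?j ` ?F"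
      by (auto simp: faces_def face_of_def dest: orbit_nonempty[THEN not_sym, THEN notE])
    show ?thesis
    proof (rule equals0I)
      fix A assume A: "A \<in> image ?j ` ?F \<inter> image ?R ` image ?j ` ?F"
      then obtain z where z: "z \<in> A" using ne by fastforce
      show False using al1[OF z IntD1[OF A]] al2[OF z IntD2[OF A]] by contradiction
    qed
  qed
  moreover have "card (image ?j ` ?F) = card ?F"
    by (intro card_image inj_on_image) (auto simp: inj_on_def)
  moreover have "card (image ?R ` image ?j ` ?F) = card (image ?j ` ?F)"
    by (intro card_image inj_on_image) (metis inj_onI rev_flag_rev_flag)
  ultimately show ?thesis
    by (simp add: card_Un_disjoint faces_def)
qed

abbreviation base_face :: "'b \<Rightarrow> 'b set" where
  "base_face \<equiv> face_of \<iota> \<sigma>\<^sub>0"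

lemma self_in_base_face: "a \<in> base_face a"
  unfolding face_of_def by (intro permutation_self_in_orbit permutation_face_succ rotation)

lemma base_face_eq_iff: "base_face b = base_face a \<longleftrightarrow> b \<in> base_face a"
  unfolding face_of_def by (intro orbit_eq_iff permutation_face_succ rotation)

lemma base_face_phi [simp]: "base_face (\<phi> a) = base_face a"
  unfolding face_of_def by (intro permutation_orbit_step permutation_face_succ rotation)

text \<open>The base face in which the flag lies: the face to the right of an arc is the one that
  traverses its reverse.\<close>

definition flag_face :: "'b \<times> bool \<Rightarrow> 'b set" where
  "flag_face k = base_face (if snd k then \<iota> (fst k) else fst k)"

lemma flag_face_flag_succ [simp]: "flag_face (flag_succ \<iota> \<sigma>\<^sub>0 k) = flag_face k"
proof (cases k)
  case (Pair b s)
  \<comment> \<open>On the right side a flag moves backwards along the boundary of its face, so the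
    new position is advanced by one step to reach the old one.\<close>
  have "base_face (\<iota> (\<sigma>\<^sub>0 (\<sigma>\<^sub>0 (\<iota> b)))) = base_face (\<phi> (\<iota> (\<sigma>\<^sub>0 (\<sigma>\<^sub>0 (\<iota> b)))))" by simp
  also have "\<phi> (\<iota> (\<sigma>\<^sub>0 (\<sigma>\<^sub>0 (\<iota> b)))) = \<iota> b" by (simp add: face_succ_def)
  finally show ?thesis
    using Pair base_face_phi[of b] by (auto simp: flag_face_def flag_succ_def face_succ_def)
qed

lemma snd_flag_succ [simp]: "snd (flag_succ \<iota> \<sigma>\<^sub>0 k) = snd k"
  by (cases k) (simp add: flag_succ_def)

lemma flag_succ_arc: "k \<in> flags \<Longrightarrow> flag_succ \<iota> \<sigma>\<^sub>0 k \<in> flags"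
  using flag_succ_permutes by (simp only: permutes_in_image)

lemma facial_segment_on_face:
  assumes "facial_segment \<iota> \<sigma> ws" "ws \<noteq> []" "W \<in> faces G \<iota> \<sigma>" "hd ws \<in> W"
  shows "set ws \<subseteq> W"
proof -
  have "ws ! i \<in> W" if "i < length ws" for i
    using that
  proof (induction i)
    case 0
    then show ?case using assms by (simp add: hd_conv_nth)
  next
    case (Suc i)
    then have "ws ! Suc i = face_succ \<iota> \<sigma> (ws ! i)" "ws ! i \<in> W"
      using assms(1) by (auto simp: facial_segment_def)
    then show ?case
      using assms(3) by (auto simp: faces_def face_of_def intro: orbit.step)
  qed
  then show ?thesis by (auto simp: in_set_conv_nth)
qed

end

subsection \<open>Two cuts meeting in two faces\<close>

text \<open>
  \<open>e w\<close> enumerates the boundary walk of \<open>w\<close>, which has length \<open>N w\<close>. Consecutiveness of the two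
  edge sets at \<open>w\<close> becomes \<open>0 \<le> m w < h w \<le> l w < N w\<close>: the first cut occupies positions
  between \<open>0\<close> and \<open>m w\<close>, the second positions between \<open>h w\<close> and \<open>l w\<close>.
\<close>

locale cubic_phi = cubic_map +
  fixes X1 X2 :: "'a \<Rightarrow> bool" and u v :: "'b set" and e :: "'b set \<Rightarrow> nat \<Rightarrow> 'b"
    and m h l N :: "'b set \<Rightarrow> nat"
  assumes cuts_disjoint: "cut G X1 \<inter> cut G X2 = {}"
    and u_neq_v: "u \<noteq> v"
    and common_face: "\<And>a b. a \<in> cut G X1 \<Longrightarrow> b \<in> cut G X2 \<Longrightarrow>
      base_face a = base_face b \<Longrightarrow> base_face a \<in> {u, v}"
    and e_Suc: "\<And>w k. w \<in> {u, v} \<Longrightarrow> e w (Suc k) = \<phi> (e w k)"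
    and e_period: "\<And>w. w \<in> {u, v} \<Longrightarrow> e w (N w) = e w 0"
    and face_e: "\<And>w. w \<in> {u, v} \<Longrightarrow> w = base_face (e w 0)"
    and face_e_image: "\<And>w. w \<in> {u, v} \<Longrightarrow> w = e w ` {..<N w}"
    and positions: "\<And>w. w \<in> {u, v} \<Longrightarrow> m w < h w \<and> h w \<le> l w \<and> l w < N w"
    and ends1: "\<And>w. w \<in> {u, v} \<Longrightarrow> e w 0 \<in> cut G X1 \<and> e w (m w) \<in> cut G X1"
    and ends2: "\<And>w. w \<in> {u, v} \<Longrightarrow> e w (h w) \<in> cut G X2 \<and> e w (l w) \<in> cut G X2"
    and range1: "\<And>w k. w \<in> {u, v} \<Longrightarrow> k < N w \<Longrightarrow> e w k \<in> cut G X1 \<Longrightarrow> k \<le> m w"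
    and range2: "\<And>w k. w \<in> {u, v} \<Longrightarrow> k < N w \<Longrightarrow> e w k \<in> cut G X2 \<Longrightarrow> h w \<le> k \<and> k \<le> l w"
begin

lemma e_arc:
  assumes "w \<in> {u, v}"
  shows "e w k \<in> arcs G"
proof (induction k)
  case 0
  then show ?case using ends1[OF assms] cut_arc by blast
next
  case (Suc k)
  then show ?case using e_Suc[OF assms] by simp
qed

lemma tail_e_Suc: "w \<in> {u, v} \<Longrightarrow> tail G (e w (Suc k)) = head G (e w k)"
  using e_Suc e_arc by simp

lemma face_e_eq:
  assumes "w \<in> {u, v}"
  shows "base_face (e w k) = w"
proof (induction k)
  case 0
  then show ?case using face_e[OF assms] by simp
next
  case (Suc k)
  then show ?case using e_Suc[OF assms] by simp
qed

lemma e_shift: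
  assumes "w \<in> {u, v}"
  shows "e w (N w + k) = e w k"
proof (induction k)
  case 0
  then show ?case using e_period[OF assms] by simp
next
  case (Suc k)
  then show ?case using e_Suc[OF assms] by simp
qed

lemma face_index:
  assumes "w \<in> {u, v}" "base_face a = w"
  obtains k where "k < N w" "a = e w k"
  using assms self_in_base_face[of a] face_e_image[OF assms(1)] by blast

lemma e_iota: "w \<in> {u, v} \<Longrightarrow> \<sigma>\<^sub>0 (\<sigma>\<^sub>0 (e w (Suc k))) = \<iota> (e w k)"
  using e_Suc by (simp add: face_succ_def)

text \<open>Re-basing the boundary walk of \<open>w\<close> at \<open>h w\<close> puts the second
  stretch first, so everything shown for the first cut transfers to the second.\<close>

lemma swapped:
  "cubic_phi G \<iota> \<sigma>\<^sub>0 X2 X1 u v (\<lambda>w k. e w (h w + k))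
    (\<lambda>w. l w - h w) (\<lambda>w. N w - h w) (\<lambda>w. N w + m w - h w) N"
proof (unfold_locales)
  show "cut G X2 \<inter> cut G X1 = {}" using cuts_disjoint by blast
  show "u \<noteq> v" by (rule u_neq_v)
  show "base_face a \<in> {u, v}" if "a \<in> cut G X2" "b \<in> cut G X1" "base_face a = base_face b" for a b
    using common_face[OF that(2,1)] that(3) by simp
  fix w assume w: "w \<in> {u, v}"
  note pos = positions[OF w]
  show "e w (h w + Suc k) = \<phi> (e w (h w + k))" for k using e_Suc[OF w] by simp
  show "e w (h w + N w) = e w (h w + 0)" using e_shift[OF w, of "h w"] by (simp add: add.commute)
  show "w = base_face (e w (h w + 0))" using face_e_eq[OF w] by simp
  show "w = (\<lambda>k. e w (h w + k)) ` {..<N w}"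
  proof
    show "(\<lambda>k. e w (h w + k)) ` {..<N w} \<subseteq> w"
      using face_e_eq[OF w] self_in_base_face by blast
    show "w \<subseteq> (\<lambda>k. e w (h w + k)) ` {..<N w}"
    proof
      fix a assume "a \<in> w"
      then obtain k where k: "k < N w" "a = e w k" using face_e_image[OF w] by blast
      show "a \<in> (\<lambda>k. e w (h w + k)) ` {..<N w}"
      proof (cases "h w \<le> k")
        case True
        then show ?thesis using k by (intro image_eqI[of _ _ "k - h w"]) auto
      next
        case False
        then have "a = e w (h w + (N w + k - h w))" using k e_shift[OF w, of k] pos by simp
        then show ?thesis using False k by (intro image_eqI[of _ _ "N w + k - h w"]) auto
      qed
    qed
  qed
  show "l w - h w < N w - h w \<and> N w - h w \<le> N w + m w - h w \<and> N w + m w - h w < N w"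
    using pos by linarith
  show "e w (h w + 0) \<in> cut G X2 \<and> e w (h w + (l w - h w)) \<in> cut G X2"
    using ends2[OF w] pos by simp
  show "e w (h w + (N w - h w)) \<in> cut G X1 \<and> e w (h w + (N w + m w - h w)) \<in> cut G X1"
    using ends1[OF w] pos e_shift[OF w, of 0] e_shift[OF w, of "m w"] by simp
  fix k assume k: "k < N w"
  \<comment> \<open>Positions beyond the end of the walk wrap around to its beginning.\<close>
  have low: "e w (h w + k) = e w (h w + k - N w)" if "N w \<le> h w + k"
    using that e_shift[OF w, of "h w + k - N w"] by simp
  show "k \<le> l w - h w" if "e w (h w + k) \<in> cut G X2"
  proof (cases "h w + k < N w")
    case True
    then show ?thesis using range2[OF w True that] by linarith
  next
    case False
    then have "h w + k - N w < N w" "e w (h w + k - N w) \<in> cut G X2" using k pos low that by auto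
    then show ?thesis using range2[OF w] False k by fastforce
  qed
  show "N w - h w \<le> k \<and> k \<le> N w + m w - h w" if "e w (h w + k) \<in> cut G X1"
  proof (cases "h w + k < N w")
    case True
    then show ?thesis using range1[OF w True that] pos by linarith
  next
    case False
    then have "h w + k - N w < N w" "e w (h w + k - N w) \<in> cut G X1" using k pos low that by auto
    then show ?thesis using range1[OF w] False k by fastforce
  qed
qed

text \<open>
  Neither cut is crossed in the gaps between the two stretches of \<open>w\<close>, and the gaps lie on the
  same sides of both cuts: \<open>bit1 w\<close> and \<open>bit2 w\<close> record which.
\<close>

definition bit1 :: "'b set \<Rightarrow> bool" where
  "bit1 w = X1 (head G (e w (m w)))"

definition bit2 :: "'b set \<Rightarrow> bool" where
  "bit2 w = X2 (head G (e w (m w)))"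

text \<open>The last flags of the stretch of the first cut on the two sides of the walk \<open>w\<close>.\<close>

definition exit1 :: "'b set \<Rightarrow> bool \<Rightarrow> 'b \<times> bool" where
  "exit1 w s = (if s then (\<iota> (e w 0), True) else (e w (m w), False))"

text \<open>From the last arc of the first stretch through both gaps and the second stretch; index
  \<open>N w\<close> is the first arc \<open>e w 0\<close> again, so both delimiters are
  included.\<close>

definition subwalk1 :: "'b set \<Rightarrow> 'b list" where
  "subwalk1 w = map (e w) [m w..<Suc (N w)]"

lemma uncut_step:
  assumes "w \<in> {u, v}" "e w (Suc k) \<notin> cut G Y"
  shows "Y (head G (e w (Suc k))) = Y (head G (e w k))"
  using assms e_arc[OF assms(1), of "Suc k"] tail_e_Suc[OF assms(1), of k] by (simp add: cut_def)

lemma uncut_const: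
  assumes w: "w \<in> {u, v}" and "i \<le> k" and "\<And>j. i < j \<Longrightarrow> j \<le> k \<Longrightarrow> e w j \<notin> cut G Y"
  shows "Y (head G (e w k)) = Y (head G (e w i))"
  using assms(2,3)
proof (induction k rule: dec_induct)
  case (step n)
  then have "e w (Suc n) \<notin> cut G Y" by simp
  from uncut_step[OF w this] step show ?case by simp
qed simp

lemma tail_e_0:
  assumes "w \<in> {u, v}"
  shows "tail G (e w 0) = head G (e w (N w - 1))"
  using tail_e_Suc[OF assms, of "N w - 1"] e_period[OF assms] positions[OF assms] by simp

lemma bit1_head:
  assumes w: "w \<in> {u, v}" and "m w \<le> k" "k < N w"
  shows "X1 (head G (e w k)) = bit1 w"
  unfolding bit1_def
proof (rule uncut_const[OF w assms(2)])
  fix j assume "m w < j" "j \<le> k"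
  then show "e w j \<notin> cut G X1" using range1[OF w, of j] assms(3) by auto
qed

lemma bit1_tail: "w \<in> {u, v} \<Longrightarrow> X1 (tail G (e w 0)) = bit1 w"
  using tail_e_0 bit1_head[of w "N w - 1"] positions[of w] by fastforce

lemma bit2_head_low:
  assumes w: "w \<in> {u, v}" and "k < h w"
  shows "X2 (head G (e w k)) = bit2 w"
proof -
  have not: "e w j \<notin> cut G X2" if "j < h w" for j
    using range2[OF w, of j] positions[OF w] that by auto
  have "X2 (head G (e w j)) = X2 (head G (e w 0))" if "j < h w" for j
    by (rule uncut_const[OF w]) (use not that in auto)
  from this[of k] this[of "m w"] show ?thesis
    using assms(2) positions[OF w] by (simp add: bit2_def)
qed

lemma bit2_tail:
  assumes w: "w \<in> {u, v}"
  shows "X2 (tail G (e w 0)) = bit2 w"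
proof -
  have "e w 0 \<notin> cut G X2" using ends1[OF w] cuts_disjoint by blast
  then have "X2 (tail G (e w 0)) = X2 (head G (e w 0))"
    using e_arc[OF w] by (simp add: cut_def)
  then show ?thesis using bit2_head_low[OF w, of 0] positions[OF w] by simp
qed

text \<open>The gap after \<open>l w\<close> continues around position 0 into the other gap, and on
  the way the walk crosses only the first cut.\<close>

lemma bit2_head_high:
  assumes w: "w \<in> {u, v}" and "l w \<le> k" "k < N w"
  shows "X2 (head G (e w k)) = bit2 w"
proof -
  have "X2 (head G (e w j)) = X2 (head G (e w (l w)))" if "l w \<le> j" "j < N w" for j
  proof (rule uncut_const[OF w that(1)])
    fix i assume "l w < i" "i \<le> j"
    then show "e w i \<notin> cut G X2" using range2[OF w, of i] that(2) by auto
  qed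
  from this[of "N w - 1"] this[of k] show ?thesis
    using assms tail_e_0[OF w] bit2_tail[OF w] by fastforce
qed


section \<open>Stable subwalks of the embedding flipped at the first cut\<close>

lemma subwalk1_simps:
  assumes "w \<in> {u, v}"
  shows "length (subwalk1 w) = Suc (N w) - m w" "subwalk1 w \<noteq> []"
    "\<And>i. i < Suc (N w) - m w \<Longrightarrow> subwalk1 w ! i = e w (m w + i)"
    "hd (subwalk1 w) = e w (m w)" "last (subwalk1 w) = e w 0"
    "butlast (tl (subwalk1 w)) = map (e w) [Suc (m w)..<N w]"
proof -
  have "[m w..<Suc (N w)] = m w # [Suc (m w)..<N w] @ [N w]"
    using positions[OF assms] upt_conv_Cons[of "m w" "Suc (N w)"] by simp
  then have *: "subwalk1 w = e w (m w) # map (e w) [Suc (m w)..<N w] @ [e w (N w)]"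
    by (simp add: subwalk1_def)
  show "subwalk1 w \<noteq> []" "hd (subwalk1 w) = e w (m w)" "last (subwalk1 w) = e w 0"
    "butlast (tl (subwalk1 w)) = map (e w) [Suc (m w)..<N w]"
    using e_period[OF assms] by (simp_all add: * butlast_append)
qed (simp_all add: subwalk1_def nth_map_upt del: upt_Suc)

lemma stable_subwalk1:
  assumes w: "w \<in> {u, v}"
  shows "stable_subwalk G \<iota> \<sigma>\<^sub>0 (flip G \<sigma>\<^sub>0 X1) w (subwalk1 w)"
proof -
  note s = subwalk1_simps[OF w] and pos = positions[OF w]
  have "facial_segment \<iota> \<sigma>\<^sub>0 (subwalk1 w)"
    unfolding facial_segment_def using s(1,3) e_Suc[OF w] by auto
  moreover have "set (subwalk1 w) \<subseteq> w"
    using face_e_eq[OF w] self_in_base_face by (fastforce simp: subwalk1_def)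
  moreover have "e w k \<notin> cut G X1" if "m w < k" "k < N w" for k
    using range1[OF w, of k] that by auto
  ultimately show ?thesis
    using ends1[OF w] pos
    unfolding stable_subwalk_def s unstable_arcs_flip by auto
qed

text \<open>From the interior arc \<open>e w (h w)\<close> the subwalk must extend in both
  directions exactly to the nearest arcs of the first cut.\<close>

lemma stable_subwalk_unique:
  assumes w: "w \<in> {u, v}" and ws: "stable_subwalk G \<iota> \<sigma>\<^sub>0 (flip G \<sigma>\<^sub>0 X1) w ws"
    and mem: "e w (h w) \<in> set (butlast (tl ws))"
  shows "ws = subwalk1 w"
proof -
  note pos = positions[OF w]
  let ?n = "length ws"
  have len: "2 \<le> ?n" and seg: "\<And>i. Suc i < ?n \<Longrightarrow> ws ! Suc i = \<phi> (ws ! i)"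
    and hd: "ws ! 0 \<in> cut G X1" and last: "ws ! (?n - 1) \<in> cut G X1"
    and int: "set (butlast (tl ws)) \<inter> cut G X1 = {}"
    using ws unfolding stable_subwalk_def facial_segment_def unstable_arcs_flip
    by (auto simp: hd_conv_nth last_conv_nth simp flip: length_greater_0_conv)
  have nth: "butlast (tl ws) ! i = ws ! Suc i" if "i < ?n - 2" for i
    using that by (simp add: nth_butlast nth_tl)
  have inner: "ws ! i \<notin> cut G X1" if "0 < i" "i < ?n - 1" for i
  proof -
    have "i - 1 < ?n - 2" "Suc (i - 1) = i" "i - 1 < length (butlast (tl ws))" using that by auto
    then have "ws ! i \<in> set (butlast (tl ws))" using nth[of "i - 1"] nth_mem by metis
    then show ?thesis using int by blast
  qed
  obtain i where i: "0 < i" "i < ?n - 1" "ws ! i = e w (h w)"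
  proof -
    obtain j where "j < length (butlast (tl ws))" "butlast (tl ws) ! j = e w (h w)"
      using mem by (auto simp: in_set_conv_nth)
    then show ?thesis using nth[of j] that[of "Suc j"] by simp
  qed
  have up: "ws ! (i + j) = e w (h w + j)" if "i + j < ?n" for j
    using that by (induction j) (use i seg e_Suc[OF w] in auto)
  have down: "ws ! (i - j) = e w (h w - j)" if "j \<le> i" "j \<le> h w" for j
    using that
  proof (induction j)
    case (Suc j)
    then have "\<phi> (ws ! (i - Suc j)) = ws ! (i - j)"
      using seg[of "i - Suc j"] i by (simp add: Suc_diff_Suc)
    also have "\<dots> = \<phi> (e w (h w - Suc j))"
      using Suc e_Suc[OF w, of "h w - Suc j"] by (simp add: Suc_diff_Suc)
    finally show ?case
      using face_succ_permutes[OF rotation] by (metis permutes_inj injD)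
  qed (use i in simp)
  \<comment> \<open>A larger \<open>i\<close> would put \<open>e w (m w)\<close> into the interior,
    a smaller one would make \<open>ws\<close> start with an arc of the gap, which is not in the
    first cut.\<close>
  have "i \<le> h w - m w"
  proof (rule ccontr)
    assume gt: "\<not> i \<le> h w - m w"
    then have "ws ! (i - (h w - m w)) \<notin> cut G X1" using i by (intro inner) auto
    then show False using down[of "h w - m w"] gt ends1[OF w] pos by simp
  qed
  moreover have "\<not> i < h w - m w"
  proof
    assume lt: "i < h w - m w"
    then have "e w (h w - i) \<in> cut G X1" "h w - i < N w" using down[of i] hd pos by auto
    then show False using range1[OF w, of "h w - i"] lt by simp
  qed
  ultimately have i_eq: "i = h w - m w" by simp
  have all: "ws ! k = e w (m w + k)" if "k < ?n" for k
  proof (cases "k \<le> i")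
    case True
    then have "i - (i - k) = k" "h w - (i - k) = m w + k" "i - k \<le> h w" using i_eq pos by auto
    then show ?thesis using down[of "i - k"] by simp
  next
    case False
    then have "i + (k - i) = k" "h w + (k - i) = m w + k" using i_eq pos by auto
    then show ?thesis using up[of "k - i"] that by simp
  qed
  have "\<not> m w + (?n - 1) < N w"
    using range1[OF w, of "m w + (?n - 1)"] all[of "?n - 1"] last len by auto
  moreover have "\<not> N w < m w + (?n - 1)"
  proof
    assume "N w < m w + (?n - 1)"
    then have "0 < N w - m w" "N w - m w < ?n - 1" using pos by auto
    then have "ws ! (N w - m w) \<notin> cut G X1" "N w - m w < ?n" using inner by auto
    then show False using all[of "N w - m w"] pos e_period[OF w] ends1[OF w] by simp
  qed
  ultimately have "?n = Suc (N w) - m w" using len by simp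
  then show ?thesis
    using all subwalk1_simps[OF w] by (intro nth_equalityI) auto
qed

lemma subwalk_containing_1:
  assumes w: "w \<in> {u, v}" and B: "e w (h w) \<in> B" "B \<subseteq> w \<inter> cut G X2"
  shows "subwalk_containing G \<iota> \<sigma>\<^sub>0 (flip G \<sigma>\<^sub>0 X1) w B = subwalk1 w"
  unfolding subwalk_containing_def
proof (rule the_equality)
  have "B \<subseteq> set (butlast (tl (subwalk1 w)))"
  proof
    fix b assume b: "b \<in> B"
    then obtain k where k: "k < N w" "b = e w k"
      using B face_e_image[OF w] by blast
    then have "h w \<le> k" using range2[OF w, of k] B b by auto
    then show "b \<in> set (butlast (tl (subwalk1 w)))"
      unfolding subwalk1_simps(6)[OF w] using k positions[OF w] by auto
  qed
  then show "stable_subwalk G \<iota> \<sigma>\<^sub>0 (flip G \<sigma>\<^sub>0 X1) w (subwalk1 w) \<and>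
    B \<subseteq> set (butlast (tl (subwalk1 w)))"
    using stable_subwalk1[OF w] by blast
qed (use stable_subwalk_unique[OF w] B in blast)

text \<open>All vertices inside the subwalk have the same value of \<open>X1\<close>, namely
  \<open>bit1 w\<close>. If they are unflipped a facial walk can follow it only forwards, if flipped
  only backwards, and the first arc is then that of \<open>exit1 w (bit1 w)\<close>.\<close>

lemma on_facial_walk_subwalk1:
  assumes w: "w \<in> {u, v}" and W: "W \<in> faces G \<iota> (flip G \<sigma>\<^sub>0 X1)"
  shows "on_facial_walk \<iota> (flip G \<sigma>\<^sub>0 X1) W (subwalk1 w) \<longleftrightarrow> fst (exit1 w (bit1 w)) \<in> W"
proof -
  let ?f = "flip G \<sigma>\<^sub>0 X1" and ?U = "subwalk1 w" and ?V = "rev (map \<iota> (subwalk1 w))"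
  note s = subwalk1_simps[OF w] and pos = positions[OF w]
  have bit: "X1 (tail G (\<iota> (e w k))) = bit1 w" if "m w \<le> k" "k < N w" for k
    using bit1_head[OF w that] e_arc[OF w] by simp
  have bit': "X1 (tail G (e w (Suc k))) = bit1 w" if "m w \<le> k" "k < N w" for k
    using bit1_head[OF w that] tail_e_Suc[OF w] by simp
  have V_nth: "?V ! i = \<iota> (e w (N w - i))" if "i \<le> N w - m w" for i
  proof -
    have "?V ! i = \<iota> (?U ! (N w - m w - i))"
    proof -
      have "i < length ?U" "length ?U - Suc i = N w - m w - i" "N w - m w - i < length ?U"
        using that pos s(1) by auto
      then show ?thesis by (simp add: rev_nth)
    qed
    also have "?U ! (N w - m w - i) = e w (m w + (N w - m w - i))"
      using that pos by (intro s(3)) linarith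
    also have "m w + (N w - m w - i) = N w - i" using that pos by linarith
    finally show ?thesis .
  qed
  have V_len: "length ?V = Suc (N w) - m w" using s(1) by simp
  have lt1: "Suc 0 < Suc (N w) - m w" using pos by linarith
  have V_ne: "?V \<noteq> []" using s(2) by simp
  have hdU: "hd ?U = fst (exit1 w False)" using s(4) by (simp add: exit1_def)
  have hdV: "hd ?V = fst (exit1 w True)"
    using V_nth[of 0] hd_conv_nth[OF V_ne] e_period[OF w] by (simp add: exit1_def)
  have segU: "facial_segment \<iota> ?f ?U \<longleftrightarrow> \<not> bit1 w"
  proof
    assume "facial_segment \<iota> ?f ?U"
    then have "?U ! Suc 0 = ?f (\<iota> (?U ! 0))"
      using s(1) lt1 by (auto simp: facial_segment_def face_succ_def)
    then have "e w (Suc (m w)) = ?f (\<iota> (e w (m w)))" using s(3)[of 0] s(3)[of 1] lt1 by simp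
    then have "\<sigma>\<^sub>0 (\<iota> (e w (m w))) = ?f (\<iota> (e w (m w)))" using e_Suc[OF w] by (simp add: face_succ_def)
    then show "\<not> bit1 w"
      using bit[of "m w"] pos not_sym[OF rotation_arc(3)[of "\<sigma>\<^sub>0 (\<iota> (e w (m w)))"]] e_arc[OF w]
      by (auto simp: flip_def)
  next
    assume "\<not> bit1 w"
    then show "facial_segment \<iota> ?f ?U"
      using bit s(1,3) e_Suc[OF w] by (auto simp: facial_segment_def face_succ_def flip_def)
  qed
  have segV: "facial_segment \<iota> ?f ?V \<longleftrightarrow> bit1 w"
  proof
    assume seg: "facial_segment \<iota> ?f ?V"
    have "?V ! Suc 0 = ?f (\<iota> (?V ! 0))"
      using seg V_len lt1 unfolding facial_segment_def face_succ_def by auto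
    then have "\<iota> (e w (N w - 1)) = ?f (e w (Suc (N w - 1)))"
      using V_nth[of 0] V_nth[of 1] lt1 by simp
    then have "\<sigma>\<^sub>0 (\<sigma>\<^sub>0 (e w (Suc (N w - 1)))) = ?f (e w (Suc (N w - 1)))"
      using e_iota[OF w] by simp
    moreover have "X1 (tail G (e w (Suc (N w - 1)))) = bit1 w" using pos by (intro bit') auto
    ultimately show "bit1 w"
      using rotation_arc(3)[of "\<sigma>\<^sub>0 (e w (Suc (N w - 1)))"] e_arc[OF w]
      by (auto simp: flip_def split: if_splits)
  next
    assume b: "bit1 w"
    have "?V ! Suc i = ?f (\<iota> (?V ! i))" if "Suc i < length ?V" for i
    proof -
      have i: "i < N w - m w" using that V_len by simp
      then have "?V ! Suc i = \<iota> (e w (N w - Suc i))" "\<iota> (?V ! i) = e w (Suc (N w - Suc i))"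
        using V_nth[of i] V_nth[of "Suc i"] pos by (simp_all add: Suc_diff_Suc)
      moreover have "?f (e w (Suc (N w - Suc i))) = \<iota> (e w (N w - Suc i))"
        using bit'[of "N w - Suc i"] b i e_iota[OF w] by (simp add: flip_def)
      ultimately show ?thesis by simp
    qed
    then show "facial_segment \<iota> ?f ?V" by (simp add: facial_segment_def face_succ_def)
  qed
  have U: "set ?U \<subseteq> W \<longleftrightarrow> hd ?U \<in> W" if "facial_segment \<iota> ?f ?U"
    using facial_segment_on_face[OF that s(2) W] s(2) hd_in_set by blast
  have V: "set ?V \<subseteq> W \<longleftrightarrow> hd ?V \<in> W" if "facial_segment \<iota> ?f ?V"
    using facial_segment_on_face[OF that V_ne W] V_ne hd_in_set by blast
  show ?thesis
    unfolding on_facial_walk_def using U V segU segV hdU hdV by (cases "bit1 w") simp_all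
qed

text \<open>The exits on the sides given by \<open>bit1\<close> are aligned, so they share a flag
  cycle exactly when their arcs share a facial walk.\<close>

lemma same_facial_walk_subwalk1:
  "same_facial_walk G \<iota> (flip G \<sigma>\<^sub>0 X1) (subwalk1 u) (subwalk1 v) =
    of_bool (exit1 v (bit1 v) \<in> orbit (walk X1) (exit1 u (bit1 u)))"
proof -
  let ?f = "flip G \<sigma>\<^sub>0 X1"
  define a where "a w = fst (exit1 w (bit1 w))" for w
  have a: "a w \<in> arcs G" "exit1 w (bit1 w) = (a w, X1 (head G (a w)))" if w: "w \<in> {u, v}" for w
    using e_arc[OF w] bit1_head[OF w, of "m w"] bit1_tail[OF w] positions[OF w]
    by (auto simp: a_def exit1_def)
  have p: "permutation (face_succ \<iota> ?f)"
    by (intro permutation_face_succ rotation_system_flip)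
  have "(\<exists>W \<in> faces G \<iota> ?f. a u \<in> W \<and> a v \<in> W) \<longleftrightarrow> a v \<in> face_of \<iota> ?f (a u)"
  proof
    assume "\<exists>W \<in> faces G \<iota> ?f. a u \<in> W \<and> a v \<in> W"
    then show "a v \<in> face_of \<iota> ?f (a u)"
      unfolding faces_def face_of_def using orbit_eq_iff[OF p] by auto
  next
    assume "a v \<in> face_of \<iota> ?f (a u)"
    then show "\<exists>W \<in> faces G \<iota> ?f. a u \<in> W \<and> a v \<in> W"
      using a(1)[of u] permutation_self_in_orbit[OF p]
      by (intro bexI[of _ "face_of \<iota> ?f (a u)"]) (auto simp: faces_def face_of_def)
  qed
  then show ?thesis
    using orbit_walk[OF a(1)[of u], of X1] a
    by (auto simp: same_facial_walk_def on_facial_walk_subwalk1 a_def[symmetric])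
qed

section \<open>Cycles joining exits of the two common faces\<close>

lemma exit1_flags: "w \<in> {u, v} \<Longrightarrow> exit1 w s \<in> flags"
  using e_arc by (auto simp: exit1_def)

lemma aligned_exit1:
  assumes w: "w \<in> {u, v}"
  shows "aligned X1 (exit1 w s) \<longleftrightarrow> s = bit1 w"
  using e_arc[OF w] bit1_head[OF w, of "m w"] bit1_tail[OF w] positions[OF w]
  by (auto simp: aligned_def exit1_def)

lemma orbit_exit1_aligned:
  assumes "exit1 v s' \<in> orbit (walk X1) (exit1 u s)"
  shows "(s' = bit1 v) = (s = bit1 u)"
  using aligned_orbit[OF assms] exit1_flags aligned_exit1 by simp

text \<open>Between leaving the first stretch and returning to it, the walk meets no arc of the
  first cut. It thus arrives at the reversal of the exit on the other side.\<close>

lemma rev_flag_exit1: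
  assumes w: "w \<in> {u, v}"
  shows "rev_flag \<iota> (cut G X1) (exit1 w s) \<in> orbit (walk X1) (exit1 w (\<not> s))"
proof -
  let ?R = "rev_flag \<iota> (cut G X1)"
  note pos = positions[OF w]
  define E where "E j = (e w (m w + j), False)" for j
  have "walk X1 (E j) = E (Suc j)" if "j < N w - m w - 1" for j
  proof -
    have "m w + Suc j < N w" using that by linarith
    then have "e w (Suc (m w + j)) \<notin> cut G X1" using range1[OF w, of "m w + Suc j"] by auto
    then show ?thesis
      using e_Suc[OF w, of "m w + j"] by (simp add: E_def flag_succ_def twist_def face_succ_def)
  qed
  then have "E (N w - m w - 1) \<in> orbit (walk X1) (E 0)"
    by (rule funpow_in_orbit_if_agree[OF permutation_walk])
  then have "walk X1 (E (N w - m w - 1)) \<in> orbit (walk X1) (E 0)" by (rule orbit.step)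
  moreover have "E (N w - m w - 1) = (e w (N w - 1), False)" "E 0 = exit1 w False"
    using pos by (simp_all add: E_def exit1_def)
  \<comment> \<open>\<open>e w 0\<close> lies in the first cut, so the side switches on
    arrival.\<close>
  moreover have "walk X1 (e w (N w - 1), False) = (e w 0, True)"
    using e_Suc[OF w, of "N w - 1"] e_period[OF w] pos ends1[OF w]
    by (simp add: flag_succ_def twist_def face_succ_def)
  moreover have "?R (exit1 w True) = (e w 0, True)"
    using ends1[OF w] by (simp add: rev_flag_def exit1_def twist_def)
  ultimately have T: "?R (exit1 w True) \<in> orbit (walk X1) (exit1 w False)" by simp
  then have "?R (?R (exit1 w True)) \<in> orbit (walk X1) (?R (exit1 w False))"
    by (simp only: orbit_walk_rev_flag)
  then have "?R (exit1 w False) \<in> orbit (walk X1) (exit1 w True)"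
    using orbit_sym[OF permutation_walk] by simp
  then show ?thesis using T by (cases s) auto
qed

lemma orbit_exit1_Not:
  "exit1 v (\<not> s') \<in> orbit (walk X1) (exit1 u (\<not> s)) \<longleftrightarrow> exit1 v s' \<in> orbit (walk X1) (exit1 u s)"
proof -
  let ?R = "rev_flag \<iota> (cut G X1)"
  have "orbit (walk X1) (?R (exit1 u s)) = orbit (walk X1) (exit1 u (\<not> s))"
    "orbit (walk X1) (?R (exit1 v s')) = orbit (walk X1) (exit1 v (\<not> s'))"
    using rev_flag_exit1 orbit_eq_iff[OF permutation_walk] by simp_all
  then show ?thesis
    using orbit_walk_rev_flag[of X1 "exit1 v s'" "exit1 u s"] orbit_eq_iff[OF permutation_walk]
    by metis
qed

definition faces1 :: "'b set set" where
  "faces1 = base_face ` cut G X1"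

lemma cut1_face1:
  assumes "b \<in> cut G X1"
  shows "flag_face (b, s) \<in> faces1"
  using assms by (auto simp: flag_face_def faces1_def)

lemma cut2_face1:
  assumes "b \<in> cut G X2" "flag_face (b, s) \<in> faces1"
  shows "flag_face (b, s) \<in> {u, v}"
proof -
  obtain a where "a \<in> cut G X1" "base_face a = flag_face (b, s)"
    using assms(2) by (auto simp: faces1_def)
  then show ?thesis
    using common_face[of a "if s then \<iota> b else b"] assms(1) by (cases s) (simp_all add: flag_face_def)
qed

text \<open>
  A walk twisted by the first cut only meets the second cut on the faces \<open>u\<close> and \<open>v\<close>. Ignoring the
  excursion there, it stays on one side of the second cut, so a walk from \<open>u\<close> to \<open>v\<close> forces
  \<open>bit2 u = bit2 v\<close>. This is what rules out inconsistent orientations in the final count.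
\<close>

definition side2 :: "'b \<times> bool \<Rightarrow> bool" where
  "side2 k = (if flag_face k \<in> {u, v} then bit2 (flag_face k) else X2 (head G (fst k)))"

text \<open>On \<open>u\<close> or \<open>v\<close> such an arc belongs to the first stretch, where
  \<open>X2\<close> equals \<open>bit2\<close>; outside the second cut both ends of the arc agree.
  So \<open>side2\<close> does not notice a switch of sides here.\<close>

lemma side2_cut1:
  assumes b: "b \<in> cut G X1"
  shows "side2 (b, s) = X2 (head G b)"
proof (cases "flag_face (b, s) \<in> {u, v}")
  case True
  define c where "c = (if s then \<iota> b else b)"
  have c: "c \<in> cut G X1" using b by (simp add: c_def)
  have w: "base_face c \<in> {u, v}" using True by (cases s) (simp_all add: flag_face_def c_def)
  obtain k where k: "k < N (base_face c)" "c = e (base_face c) k"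
    using face_index[OF w] by metis
  then have "k \<le> m (base_face c)" using range1[OF w k(1)] c by simp
  then have "X2 (head G c) = bit2 (base_face c)"
    using bit2_head_low[OF w, of k] k(2) positions[OF w] by simp
  moreover have "X2 (head G b) = X2 (tail G b)"
    using b cuts_disjoint by (auto simp: cut_def)
  ultimately show ?thesis
    using w cut_arc[OF b] by (cases s) (auto simp: side2_def c_def flag_face_def)
qed (simp add: side2_def)

lemma walk1_faces1:
  assumes "k \<in> flags" "flag_face k \<in> faces1"
  shows "walk X1 k \<in> flags \<and> flag_face (walk X1 k) \<in> faces1 \<and> side2 (walk X1 k) = side2 k"
proof -
  let ?k = "flag_succ \<iota> \<sigma>\<^sub>0 k"
  obtain b s where k: "k = (b, s)" by fastforce
  obtain b' where k': "?k = (b', s)" by (simp add: k flag_succ_def)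
  have b: "b \<in> arcs G" "b' \<in> arcs G" "tail G b' = head G b"
    using assms(1) flag_succ_arc[OF assms(1)] k k' by (auto simp: flag_succ_def split: if_splits)
  have f: "flag_face (b', s) = flag_face (b, s)" by (metis flag_face_flag_succ k k')
  have s: "side2 (b', s) = side2 (b, s)"
  proof (cases "flag_face (b, s) \<in> {u, v}")
    case False
    \<comment> \<open>A face of the first cut that meets the second cut is \<open>u\<close> or
      \<open>v\<close>.\<close>
    then have "b' \<notin> cut G X2" using cut2_face1[of b' s] f assms k by auto
    then show ?thesis using False f b by (auto simp: side2_def cut_def)
  qed (simp add: side2_def f)
  show ?thesis
  proof (cases "b' \<in> cut G X1")
    case True
    then have "walk X1 k = (b', \<not> s)" using k' by (simp add: twist_def)
    then show ?thesis
      using b s k side2_cut1[OF True] cut1_face1[OF True] by simp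
  next
    case False
    then have "walk X1 k = (b', s)" using k' by (simp add: twist_def)
    then show ?thesis using b s k f assms by simp
  qed
qed

lemma exit1_face: "w \<in> {u, v} \<Longrightarrow> flag_face (exit1 w s) = w"
  using face_e_eq by (auto simp: flag_face_def exit1_def)

lemma orbit_exit1_bit2:
  assumes "exit1 v s' \<in> orbit (walk X1) (exit1 u s)"
  shows "bit2 v = bit2 u"
proof -
  have "u \<in> faces1" using ends1[of u] face_e[of u] by (auto simp: faces1_def)
  then have u: "exit1 u s \<in> flags" "flag_face (exit1 u s) \<in> faces1"
    using exit1_flags exit1_face by simp_all
  from assms have "exit1 v s' \<in> flags \<and> flag_face (exit1 v s') \<in> faces1
      \<and> side2 (exit1 v s') = side2 (exit1 u s)"
  proof induct
    case base
    show ?case by (rule walk1_faces1[OF u])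
  next
    case (step y)
    then show ?case using walk1_faces1[of y] by simp
  qed
  then show ?thesis by (simp add: side2_def exit1_face)
qed


section \<open>Separating the flags into two halves\<close>

definition exit2 :: "'b set \<Rightarrow> bool \<Rightarrow> 'b \<times> bool" where
  "exit2 w s = (if s then (\<iota> (e w (h w)), True) else (e w (l w), False))"

text \<open>Each stretch takes along the gap that precedes it in the direction of travel: on the
  left from beyond \<open>l w\<close> around to \<open>m w\<close>, on the right backwards from
  below \<open>h w\<close> down to 0.\<close>

definition stretch1 :: "('b \<times> bool) set" where
  "stretch1 = (\<Union>w \<in> {u, v}. {(e w j, False) | j. j < N w \<and> (j \<le> m w \<or> l w < j)}
    \<union> {(\<iota> (e w j), True) | j. j < h w})"

definition flags1 :: "('b \<times> bool) set" where
  "flags1 = {k \<in> flags. flag_face k \<in> faces1 \<and> (flag_face k \<in> {u, v} \<longrightarrow> k \<in> stretch1)}"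

lemma exit2_face: "w \<in> {u, v} \<Longrightarrow> flag_face (exit2 w s) = w"
  using face_e_eq by (auto simp: flag_face_def exit2_def)

lemma fst_exit:
  assumes "w \<in> {u, v}"
  shows "fst (exit1 w s) \<in> cut G X1" "fst (exit2 w s) \<in> cut G X2" "snd (exit1 w s) = s" "snd (exit2 w s) = s"
  using ends1[OF assms] ends2[OF assms] by (auto simp: exit1_def exit2_def)

lemma exit2_flags: "w \<in> {u, v} \<Longrightarrow> exit2 w s \<in> flags"
  using e_arc by (auto simp: exit2_def)

text \<open>All four exits of \<open>w\<close> end at vertices between the two stretches, which lie
  on the same sides of both cuts. Exchanging the two exits of one side therefore preserves
  alignment.\<close>

lemma aligned_exits:
  assumes w: "w \<in> {u, v}"
  shows "aligned (\<lambda>a. X1 a \<noteq> X2 a) (exit1 w s) \<longleftrightarrow> s = (bit1 w \<noteq> bit2 w)"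
    "aligned (\<lambda>a. X1 a \<noteq> X2 a) (exit2 w s) \<longleftrightarrow> s = (bit1 w \<noteq> bit2 w)"
proof -
  note pos = positions[OF w]
  show "aligned (\<lambda>a. X1 a \<noteq> X2 a) (exit1 w s) \<longleftrightarrow> s = (bit1 w \<noteq> bit2 w)"
    using bit1_head[OF w, of "m w"] bit2_head_low[OF w, of "m w"] bit1_tail[OF w] bit2_tail[OF w]
      e_arc[OF w] pos by (auto simp: aligned_def exit1_def)
  have "tail G (e w (h w)) = head G (e w (h w - 1))"
    using tail_e_Suc[OF w, of "h w - 1"] pos by simp
  moreover have "m w \<le> h w - 1" "h w - 1 < N w" "h w - 1 < h w" using pos by auto
  ultimately show "aligned (\<lambda>a. X1 a \<noteq> X2 a) (exit2 w s) \<longleftrightarrow> s = (bit1 w \<noteq> bit2 w)"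
    using bit1_head[OF w, of "l w"] bit2_head_high[OF w, of "l w"]
      bit1_head[OF w, of "h w - 1"] bit2_head_low[OF w, of "h w - 1"]
      e_arc[OF w] pos by (auto simp: aligned_def exit2_def)
qed

text \<open>Together with \<open>cut2_flags1\<close> this confines each twist to its own
  half.\<close>

lemma cut1_flags1: "cut G X1 \<times> UNIV \<subseteq> flags1"
proof clarify
  fix b s assume b: "b \<in> cut G X1"
  have "(b, s) \<in> stretch1" if "flag_face (b, s) \<in> {u, v}"
  proof -
    define c where "c = (if s then \<iota> b else b)"
    have c: "c \<in> cut G X1" using b by (simp add: c_def)
    have w: "base_face c \<in> {u, v}" using that by (cases s) (simp_all add: flag_face_def c_def)
    obtain k where k: "k < N (base_face c)" "c = e (base_face c) k"
      using face_index[OF w] by metis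
    then have "k \<le> m (base_face c)" using range1[OF w k(1)] c by simp
    moreover have "(b, s) = (if s then (\<iota> c, True) else (c, False))" by (simp add: c_def)
    ultimately show ?thesis
      unfolding stretch1_def using w k positions[OF w]
      by (intro UN_I[OF w]) (auto intro!: exI[of _ k])
  qed
  then show "(b, s) \<in> flags1"
    using b cut1_face1[OF b] cut_arc by (auto simp: flags1_def)
qed

lemma cut2_flags1: "cut G X2 \<times> UNIV \<subseteq> flags - flags1"
proof clarify
  fix b s assume b: "b \<in> cut G X2"
  have "(b, s) \<notin> stretch1"
  proof
    assume "(b, s) \<in> stretch1"
    then obtain w j where w: "w \<in> {u, v}"
      and j: "b = e w j \<and> j < N w \<and> (j \<le> m w \<or> l w < j) \<or> b = \<iota> (e w j) \<and> j < h w"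
      unfolding stretch1_def by blast
    then have "e w j \<in> cut G X2" "j < N w" "j < h w \<or> l w < j"
      using b positions[OF w] by auto
    then show False using range2[OF w, of j] by simp
  qed
  then show "(b, s) \<in> flags - flags1"
    using cut2_face1[OF b, of s] b cut_arc by (auto simp: flags1_def)
qed

lemma flag_succ_False:
  "w \<in> {u, v} \<Longrightarrow> flag_succ \<iota> \<sigma>\<^sub>0 (e w j, False) = (e w (Suc j), False)"
  using e_Suc by (simp add: flag_succ_def face_succ_def)

lemma flag_succ_True:
  "w \<in> {u, v} \<Longrightarrow> flag_succ \<iota> \<sigma>\<^sub>0 (\<iota> (e w (Suc j)), True) = (\<iota> (e w j), True)"
  using e_iota by (simp add: flag_succ_def)

lemma flag_succ_exit2_stretch1:
  assumes w: "w \<in> {u, v}"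
  shows "flag_succ \<iota> \<sigma>\<^sub>0 (exit2 w s) \<in> stretch1"
proof (cases s)
  case True
  obtain j where j: "h w = Suc j" using positions[OF w] by (cases "h w") auto
  then have "flag_succ \<iota> \<sigma>\<^sub>0 (exit2 w s) = (\<iota> (e w j), True)"
    using True flag_succ_True[OF w] by (simp add: exit2_def)
  then show ?thesis unfolding stretch1_def using j by (intro UN_I[OF w]) auto
next
  case False
  then have *: "flag_succ \<iota> \<sigma>\<^sub>0 (exit2 w s) = (e w (Suc (l w)), False)"
    using flag_succ_False[OF w] by (simp add: exit2_def)
  have "\<exists>j. e w (Suc (l w)) = e w j \<and> j < N w \<and> (j \<le> m w \<or> l w < j)"
  proof (cases "Suc (l w) = N w")
    case True
    then show ?thesis using e_period[OF w] positions[OF w] by (intro exI[of _ 0]) auto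
  next
    case False
    then show ?thesis using positions[OF w] by (intro exI[of _ "Suc (l w)"]) auto
  qed
  then show ?thesis unfolding * stretch1_def by (intro UN_I[OF w]) auto
qed

text \<open>The stretch can be left only through its exits, whose successors the transpositions will
  redirect.\<close>

lemma flag_succ_stretch1:
  assumes k: "k \<in> stretch1" and not: "\<And>w s. w \<in> {u, v} \<Longrightarrow> k \<noteq> exit1 w s"
  shows "flag_succ \<iota> \<sigma>\<^sub>0 k \<in> stretch1"
proof -
  obtain w where w: "w \<in> {u, v}" and
    "k \<in> {(e w j, False) | j. j < N w \<and> (j \<le> m w \<or> l w < j)} \<union> {(\<iota> (e w j), True) | j. j < h w}"
    using k unfolding stretch1_def by blast
  then consider j where "k = (e w j, False)" "j < N w" "j \<le> m w \<or> l w < j"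
    | j where "k = (\<iota> (e w j), True)" "j < h w" by blast
  then show ?thesis
  proof cases
    case 1
    have "j \<noteq> m w" using not[OF w, of False] 1 by (auto simp: exit1_def)
    have "\<exists>i. e w (Suc j) = e w i \<and> i < N w \<and> (i \<le> m w \<or> l w < i)"
    proof (cases "Suc j = N w")
      case True
      then show ?thesis using e_period[OF w] positions[OF w] by (intro exI[of _ 0]) auto
    next
      case False
      then show ?thesis using 1 \<open>j \<noteq> m w\<close> by (intro exI[of _ "Suc j"]) auto
    qed
    then show ?thesis
      unfolding stretch1_def 1(1) flag_succ_False[OF w] by (intro UN_I[OF w]) auto
  next
    case 2
    have "j \<noteq> 0" using not[OF w, of True] 2 by (intro notI) (simp add: exit1_def)
    then obtain i where "j = Suc i" by (cases j) auto
    then show ?thesis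
      unfolding stretch1_def 2(1) using flag_succ_True[OF w] 2 by (intro UN_I[OF w]) auto
  qed
qed


text \<open>
  Cutting the four flag cycles of \<open>u\<close> and \<open>v\<close> between their two stretches separates the flags
  into the two halves \<open>flags1\<close> and its complement, each of which is twisted by one cut only.
  The sign \<open>\<epsilon>\<close> pairs the directions of \<open>u\<close> and \<open>v\<close> that have the same orientation in the walk
  twisted by both cuts.
\<close>

lemma card_walk_phi:
  defines "\<epsilon> \<equiv> (bit1 u \<noteq> bit2 u) \<noteq> (bit1 v \<noteq> bit2 v)"
  shows "card (orbit (walk (\<lambda>a. X1 a \<noteq> X2 a)) ` flags) + card (orbit (walk (\<lambda>_. False)) ` flags) =
    card (orbit (walk X1) ` flags) + card (orbit (walk X2) ` flags)
    + (if exit1 v \<epsilon> \<in> orbit (walk X1) (exit1 u False)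
        \<and> exit2 v \<epsilon> \<in> orbit (walk X2) (exit2 u False) then 2 else 0)
    + (if exit1 v (\<not> \<epsilon>) \<in> orbit (walk X1) (exit1 u True)
        \<and> exit2 v (\<not> \<epsilon>) \<in> orbit (walk X2) (exit2 u True) then 2 else 0)"
proof -
  let ?p = "flag_succ \<iota> \<sigma>\<^sub>0" and ?X = "\<lambda>a. X1 a \<noteq> X2 a"
  let ?L = "[(exit1 u False, exit2 u False), (exit1 v \<epsilon>, exit2 v \<epsilon>),
    (exit1 u True, exit2 u True), (exit1 v (\<not> \<epsilon>), exit2 v (\<not> \<epsilon>))]"
  \<comment> \<open>\<open>r\<close> exchanges the successors of the two exits on each side of
    \<open>u\<close> and \<open>v\<close>, cutting each of the four base cycles in two; applying the
    transpositions again restores the base walk.\<close>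
  define r where "r = swaps ?p (rev ?L)"
  have p: "?p = swaps r ?L" unfolding r_def using swaps_rev[of ?p "rev ?L"] by simp
  have uv: "u \<in> {u, v}" "v \<in> {u, v}" by simp_all
  have fs1: "(flag_face (exit1 w s), snd (exit1 w s)) = (w, s)"
    and fs2: "(flag_face (exit2 w s), snd (exit2 w s)) = (w, s)" if "w \<in> {u, v}" for w s
    using that exit1_face exit2_face fst_exit by auto
  have ne12: "exit1 w s \<noteq> exit2 w' s'" if "w \<in> {u, v}" "w' \<in> {u, v}" for w w' s s'
    using fst_exit(1)[OF that(1), of s] fst_exit(2)[OF that(2), of s'] cuts_disjoint by auto
  have inj1: "exit1 w s = exit1 w' s' \<longleftrightarrow> (w, s) = (w', s')" if "w \<in> {u, v}" "w' \<in> {u, v}" for w w' s s'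
  proof
    assume "exit1 w s = exit1 w' s'"
    then have "(flag_face (exit1 w s), snd (exit1 w s)) = (flag_face (exit1 w' s'), snd (exit1 w' s'))"
      by (simp only:)
    then show "(w, s) = (w', s')" by (simp only: fs1 that)
  qed blast
  have inj2: "exit2 w s = exit2 w' s' \<longleftrightarrow> (w, s) = (w', s')" if "w \<in> {u, v}" "w' \<in> {u, v}" for w w' s s'
  proof
    assume "exit2 w s = exit2 w' s'"
    then have "(flag_face (exit2 w s), snd (exit2 w s)) = (flag_face (exit2 w' s'), snd (exit2 w' s'))"
      by (simp only:)
    then show "(w, s) = (w', s')" by (simp only: fs2 that)
  qed blast
  have dist: "distinct (map fst (rev ?L) @ map snd (rev ?L))"
    using u_neq_v by (auto simp: inj1[OF uv(1) uv(1)] inj1[OF uv(1) uv(2)] inj1[OF uv(2) uv(1)]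
        inj1[OF uv(2) uv(2)] inj2[OF uv(1) uv(1)] inj2[OF uv(1) uv(2)] inj2[OF uv(2) uv(1)]
        inj2[OF uv(2) uv(2)] ne12[OF uv(1) uv(1)] ne12[OF uv(1) uv(2)] ne12[OF uv(2) uv(1)]
        ne12[OF uv(2) uv(2)] ne12[OF uv(1) uv(1), symmetric] ne12[OF uv(1) uv(2), symmetric]
        ne12[OF uv(2) uv(1), symmetric] ne12[OF uv(2) uv(2), symmetric])
  have memL: "(exit1 w s, exit2 w s) \<in> set (rev ?L)" if "w \<in> {u, v}" for w s
    using that by (cases s; cases \<epsilon>) auto
  have r_exit: "r (exit1 w s) = ?p (exit2 w s)" "r (exit2 w s) = ?p (exit1 w s)"
    if "w \<in> {u, v}" for w s
    using swaps_apply[OF dist memL[OF that]] unfolding r_def by blast+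
  have r_other: "r k = ?p k" if "\<And>w s. w \<in> {u, v} \<Longrightarrow> k \<noteq> exit1 w s \<and> k \<noteq> exit2 w s" for k
    unfolding r_def by (rule swaps_apply_other) (use that uv in auto)
  have r_cases: "(\<exists>w \<in> {u, v}. \<exists>s. k = exit1 w s) \<or> (\<exists>w \<in> {u, v}. \<exists>s. k = exit2 w s) \<or> r k = ?p k" for k
    using r_other by blast
  have exit_flags: "exit1 w s \<in> flags1" "exit2 w s \<in> flags - flags1" if "w \<in> {u, v}" for w s
    using fst_exit(1,2)[OF that, of s] cut1_flags1 cut2_flags1
    by (metis SigmaI UNIV_I prod.collapse subsetD)+
  have f1: "flags1 \<subseteq> flags" by (auto simp: flags1_def)
  have un: "flags1 \<union> (flags - flags1) = flags" using f1 by blast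
  have r_perm: "r permutes flags"
    unfolding r_def
    by (rule swaps_permutes[OF flag_succ_permutes]) (use exit1_flags exit2_flags uv in auto)
  \<comment> \<open>Exchanged exits share face and side, so these are constant on cycles of
    \<open>r\<close>; this separates the four cycles within each half.\<close>
  have r_inv: "(flag_face (r k), snd (r k)) = (flag_face k, snd k)" for k
    using r_cases[of k] fs1 fs2 r_exit by auto
  have r1: "r k \<in> flags1" if k: "k \<in> flags1" for k
  proof -
    have face: "r k \<in> flags" "flag_face (r k) \<in> faces1"
      using k r_inv[of k] f1 permutes_in_image[OF r_perm] by (auto simp: flags1_def)
    have "r k \<in> stretch1" if w: "flag_face (r k) \<in> {u, v}"
    proof -
      have str: "k \<in> stretch1" using k w r_inv[of k] by (auto simp: flags1_def)
      show ?thesis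
      proof (cases "\<exists>w \<in> {u, v}. \<exists>s. k = exit1 w s")
        case True
        then show ?thesis using r_exit flag_succ_exit2_stretch1 by auto
      next
        case False
        then have not1: "k \<noteq> exit1 w s" if "w \<in> {u, v}" for w s using that by blast
        have "k \<noteq> exit2 w s" if "w \<in> {u, v}" for w s
          using exit_flags(2)[OF that, of s] k by auto
        then have "r k = ?p k" using not1 by (intro r_other) simp
        then show ?thesis using flag_succ_stretch1[OF str not1] by simp
      qed
    qed
    then show ?thesis using face by (simp add: flags1_def)
  qed
  have r2: "r k \<in> flags - flags1" if k: "k \<in> flags - flags1" for k
  proof -
    \<comment> \<open>An injection of a finite set into itself is onto, so the complement is
      preserved as well.\<close>
    have "inj_on r flags1" using r_perm by (meson inj_on_subset permutes_inj subset_UNIV)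
    then have "r ` flags1 = flags1"
      using r1 f1 finite_subset[OF f1 finite_flags] by (intro endo_inj_surj) auto
    then have "r k \<notin> flags1"
      using k inj_image_mem_iff[OF permutes_inj[OF r_perm], of k flags1] by simp
    then show ?thesis using k permutes_in_image[OF r_perm] by blast
  qed
  have perm_r: "permutation r" using finite_flags r_perm by (rule permutes_imp_permutation)
  have orb: "orbit r a \<noteq> orbit r b" if "(flag_face a, snd a) \<noteq> (flag_face b, snd b)" for a b
  proof
    assume "orbit r a = orbit r b"
    then have "b \<in> orbit r a" using permutation_self_in_orbit[OF perm_r, of b] by simp
    then show False
      using orbit_invariant[of b r a "\<lambda>k. (flag_face k, snd k)"] r_inv that by simp
  qed
  \<comment> \<open>As the cuts are disjoint, the cut of the symmetric difference is their union and
    the twists multiply.\<close>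
  have cut_X: "twist (cut G ?X) k = (twist (cut G X1) \<circ> twist (cut G X2)) k" for k
    using cuts_disjoint by (cases k) (auto simp: twist_def cut_def)
  have walk_X: "walk ?X = twist (cut G X1) \<circ> twist (cut G X2) \<circ> ?p"
    using cut_X by (simp add: fun_eq_iff)
  have al: "aligned ?X (walk ?X k) = aligned ?X k" for k
  proof (cases "k \<in> flags")
    case False
    then have "walk ?X k = k" by (rule permutes_not_in[OF walk_permutes])
    then show ?thesis by (rule arg_cong)
  qed (rule aligned_walk)
  have al': "aligned ?X (twist (cut G X1) (twist (cut G X2) (?p k))) = aligned ?X k" for k
    using al[of k] unfolding walk_X by (simp only: comp_apply)
  have al_r: "aligned ?X (twist (cut G X1) (twist (cut G X2) (r k))) = aligned ?X k" for k
  proof -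
    consider w s where "w \<in> {u, v}" "k = exit1 w s" | w s where "w \<in> {u, v}" "k = exit2 w s"
      | "r k = ?p k" using r_cases[of k] by blast
    then show ?thesis
      by cases (simp_all only: r_exit al' aligned_exits)
  qed
  \<comment> \<open>The alignment of the left exits of \<open>u\<close>; by the choice of
    \<open>\<epsilon>\<close> the paired exits of \<open>v\<close> share it.\<close>
  define c where "c \<longleftrightarrow> \<not> (bit1 u \<noteq> bit2 u)"
  let ?N = "\<lambda>q. card (orbit q ` (flags1 \<union> (flags - flags1)))"
  have "?N (twist (cut G X1) \<circ> twist (cut G X2) \<circ> ?p) + ?N ?p =
    ?N (twist (cut G X1) \<circ> ?p) + ?N (twist (cut G X2) \<circ> ?p)
    + (if exit1 v \<epsilon> \<in> orbit (walk X1) (exit1 u False)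
        \<and> exit2 v \<epsilon> \<in> orbit (walk X2) (exit2 u False) then 2 else 0)
    + (if exit1 v (\<not> \<epsilon>) \<in> orbit (walk X1) (exit1 u True)
        \<and> exit2 v (\<not> \<epsilon>) \<in> orbit (walk X2) (exit2 u True) then 2 else 0)"
  proof (rule card_orbits_glue[where r = r and Cls = "aligned ?X" and c = c])
    show "finite flags1" "finite (flags - flags1)" using f1 finite_flags by (auto intro: finite_subset)
    show "r permutes flags1 \<union> (flags - flags1)" unfolding un by (rule r_perm)
    show "twist (cut G X1) permutes flags1" "twist (cut G X2) permutes flags - flags1"
      by (rule twist_permutes[OF cut1_flags1], rule twist_permutes[OF cut2_flags1])
    show "distinct (map (orbit r) [exit1 u False, exit1 v \<epsilon>, exit1 u True, exit1 v (\<not> \<epsilon>)])"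
      using orb fs1 uv u_neq_v by simp
    show "distinct (map (orbit r) [exit2 u False, exit2 v \<epsilon>, exit2 u True, exit2 v (\<not> \<epsilon>)])"
      using orb fs2 uv u_neq_v by simp
    show "aligned ?X ` {exit1 u False, exit1 v \<epsilon>, exit2 u False, exit2 v \<epsilon>} = {c}"
      "aligned ?X ` {exit1 u True, exit1 v (\<not> \<epsilon>), exit2 u True, exit2 v (\<not> \<epsilon>)} = {\<not> c}"
      unfolding image_insert image_empty aligned_exits[OF uv(1)] aligned_exits[OF uv(2)] c_def \<epsilon>_def
      by blast+
    show "?p = swaps r ?L" by (rule p)
  qed (use r1 r2 al_r exit_flags uv in auto)
  moreover have "walk (\<lambda>_. False) = ?p"
    by (auto simp: fun_eq_iff twist_def cut_def)
  ultimately show ?thesis unfolding un walk_X by simp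
qed

text \<open>Both correction terms of the flag count turn out to be governed by the same condition.
  Together they contribute four flag cycles, that is, two faces.\<close>

lemma card_faces_phi:
  "card (faces G \<iota> (flip G \<sigma>\<^sub>0 (\<lambda>a. X1 a \<noteq> X2 a))) + card (faces G \<iota> \<sigma>\<^sub>0) =
    card (faces G \<iota> (flip G \<sigma>\<^sub>0 X1)) + card (faces G \<iota> (flip G \<sigma>\<^sub>0 X2))
    + (if exit1 v (bit1 v) \<in> orbit (walk X1) (exit1 u (bit1 u))
        \<and> exit2 v (bit2 v) \<in> orbit (walk X2) (exit2 u (bit2 u)) then 2 else 0)"
proof -
  interpret s: cubic_phi G \<iota> \<sigma>\<^sub>0 X2 X1 u v "\<lambda>w k. e w (h w + k)"
    "\<lambda>w. l w - h w" "\<lambda>w. N w - h w" "\<lambda>w. N w + m w - h w" N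
    by (rule swapped)
  have exit2: "s.exit1 w b = exit2 w b" if "w \<in> {u, v}" for w b
    using positions[OF that] by (simp add: s.exit1_def exit2_def)
  have bits: "s.bit1 w = bit2 w" "s.bit2 w = bit1 w" if "w \<in> {u, v}" for w
    using bit2_head_high[OF that, of "l w"] bit1_head[OF that, of "l w"] positions[OF that]
    by (simp_all add: s.bit1_def s.bit2_def)
  have uv: "u \<in> {u, v}" "v \<in> {u, v}" by simp_all
  let ?A = "\<lambda>b' b. exit1 v b' \<in> orbit (walk X1) (exit1 u b)"
  let ?B = "\<lambda>b' b. exit2 v b' \<in> orbit (walk X2) (exit2 u b)"
  let ?S1 = "?A (bit1 v) (bit1 u)" and ?S2 = "?B (bit2 v) (bit2 u)"
  have B_Not: "?B (\<not> b') (\<not> b) = ?B b' b" for b b'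
    using s.orbit_exit1_Not[of b' b] by (simp add: exit2[OF uv(1)] exit2[OF uv(2)])
  \<comment> \<open>By alignment, a join of any two exits is the join of the aligned ones or its
    reversal.\<close>
  have A1: ?S1 if "?A b' b" for b b'
    using orbit_exit1_aligned[OF that] that orbit_exit1_Not[of b' b]
    by (cases b; cases b'; cases "bit1 u"; cases "bit1 v") simp_all
  have B1: ?S2 if "?B b' b" for b b'
    using s.orbit_exit1_aligned[of b' b] that B_Not[of b' b]
    by (cases b; cases b'; cases "bit2 u"; cases "bit2 v")
      (simp_all add: exit2[OF uv(1)] exit2[OF uv(2)] bits[OF uv(1)] bits[OF uv(2)])
  have A2: "bit2 v = bit2 u" if ?S1 using orbit_exit1_bit2[OF that] .
  have B2: "bit1 v = bit1 u" if ?S2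
    using s.orbit_exit1_bit2[of "bit2 v" "bit2 u"] that
    by (simp add: exit2[OF uv(1)] exit2[OF uv(2)] bits[OF uv(1)] bits[OF uv(2)])
  define \<epsilon> where "\<epsilon> \<longleftrightarrow> (bit1 u \<noteq> bit2 u) \<noteq> (bit1 v \<noteq> bit2 v)"
  have eps: "?A \<epsilon> False \<and> ?B \<epsilon> False \<longleftrightarrow> ?S1 \<and> ?S2" "?A (\<not> \<epsilon>) True \<and> ?B (\<not> \<epsilon>) True \<longleftrightarrow> ?S1 \<and> ?S2"
  proof -
    \<comment> \<open>A join under one cut forces the bits of the other cut to agree. With both
      joins \<open>\<epsilon>\<close> is false, and reversal supplies the joins in both
      directions.\<close>
    have fwd: "\<not> \<epsilon> \<and> ?A False False \<and> ?B False False \<and> ?A True True \<and> ?B True True" if "?S1 \<and> ?S2"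
    proof -
      have "bit2 v = bit2 u" "bit1 v = bit1 u" using A2 B2 that by blast+
      then show ?thesis
        using that orbit_exit1_Not[of False False] B_Not[of False False]
        by (cases "bit1 u"; cases "bit2 u") (simp_all add: \<epsilon>_def)
    qed
    show "?A \<epsilon> False \<and> ?B \<epsilon> False \<longleftrightarrow> ?S1 \<and> ?S2"
    proof
      assume "?S1 \<and> ?S2"
      from fwd[OF this] show "?A \<epsilon> False \<and> ?B \<epsilon> False" by simp
    qed (use A1[of \<epsilon> False] B1[of \<epsilon> False] in simp)
    show "?A (\<not> \<epsilon>) True \<and> ?B (\<not> \<epsilon>) True \<longleftrightarrow> ?S1 \<and> ?S2"
    proof
      assume "?S1 \<and> ?S2"
      from fwd[OF this] show "?A (\<not> \<epsilon>) True \<and> ?B (\<not> \<epsilon>) True" by simp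
    qed (use A1[of "\<not> \<epsilon>" True] B1[of "\<not> \<epsilon>" True] in simp)
  qed
  have "flip G \<sigma>\<^sub>0 (\<lambda>_. False) = \<sigma>\<^sub>0" by (simp add: fun_eq_iff flip_def)
  then show ?thesis
    using card_walk_phi unfolding \<epsilon>_def[symmetric] eps card_walk_orbits by auto
qed


text \<open>Vertices and edges are common to all embeddings, so a genus difference is minus half the
  difference of the face counts.\<close>

lemma genus_diff_phi:
  "genus_diff G \<iota> \<sigma>\<^sub>0 (flip G \<sigma>\<^sub>0 (\<lambda>a. X1 a \<noteq> X2 a)) =
    genus_diff G \<iota> \<sigma>\<^sub>0 (flip G \<sigma>\<^sub>0 X1) + genus_diff G \<iota> \<sigma>\<^sub>0 (flip G \<sigma>\<^sub>0 X2)
    - same_facial_walk G \<iota> (flip G \<sigma>\<^sub>0 X1)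
        (subwalk_containing G \<iota> \<sigma>\<^sub>0 (flip G \<sigma>\<^sub>0 X1) u (u \<inter> cut G X2))
        (subwalk_containing G \<iota> \<sigma>\<^sub>0 (flip G \<sigma>\<^sub>0 X1) v (v \<inter> cut G X2))
      * same_facial_walk G \<iota> (flip G \<sigma>\<^sub>0 X2)
        (subwalk_containing G \<iota> \<sigma>\<^sub>0 (flip G \<sigma>\<^sub>0 X2) u (u \<inter> cut G X1))
        (subwalk_containing G \<iota> \<sigma>\<^sub>0 (flip G \<sigma>\<^sub>0 X2) v (v \<inter> cut G X1))"
proof -
  interpret s: cubic_phi G \<iota> \<sigma>\<^sub>0 X2 X1 u v "\<lambda>w k. e w (h w + k)"
    "\<lambda>w. l w - h w" "\<lambda>w. N w - h w" "\<lambda>w. N w + m w - h w" N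
    by (rule swapped)
  have uv: "u \<in> {u, v}" "v \<in> {u, v}" by simp_all
  have mem: "e w k \<in> w" if "w \<in> {u, v}" for w k
    using face_e_eq[OF that, of k] self_in_base_face by metis
  have exit2: "s.exit1 w b = exit2 w b" and bits: "s.bit1 w = bit2 w" if "w \<in> {u, v}" for w b
    using bit2_head_high[OF that, of "l w"] positions[OF that]
    by (simp_all add: s.exit1_def exit2_def s.bit1_def)
  have sub1: "subwalk_containing G \<iota> \<sigma>\<^sub>0 (flip G \<sigma>\<^sub>0 X1) w (w \<inter> cut G X2) = subwalk1 w"
    if "w \<in> {u, v}" for w
    using ends2[OF that] mem[OF that] by (intro subwalk_containing_1[OF that]) auto
  have sub2: "subwalk_containing G \<iota> \<sigma>\<^sub>0 (flip G \<sigma>\<^sub>0 X2) w (w \<inter> cut G X1) = s.subwalk1 w"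
    if "w \<in> {u, v}" for w
    using s.ends2[OF that] mem[OF that] by (intro s.subwalk_containing_1[OF that]) auto
  let ?S1 = "exit1 v (bit1 v) \<in> orbit (walk X1) (exit1 u (bit1 u))"
  let ?S2 = "exit2 v (bit2 v) \<in> orbit (walk X2) (exit2 u (bit2 u))"
  let ?F = "\<lambda>\<sigma>. rat_of_nat (card (faces G \<iota> \<sigma>))"
  have "?F (flip G \<sigma>\<^sub>0 (\<lambda>a. X1 a \<noteq> X2 a)) + ?F \<sigma>\<^sub>0 =
    ?F (flip G \<sigma>\<^sub>0 X1) + ?F (flip G \<sigma>\<^sub>0 X2) + 2 * (of_bool ?S1 * of_bool ?S2)"
    using arg_cong[OF card_faces_phi, of rat_of_nat] by (cases ?S1; cases ?S2) simp_all
  moreover have "same_facial_walk G \<iota> (flip G \<sigma>\<^sub>0 X2) (s.subwalk1 u) (s.subwalk1 v) = of_bool ?S2"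
    using s.same_facial_walk_subwalk1 by (simp only: exit2[OF uv(1)] exit2[OF uv(2)] bits uv)
  ultimately show ?thesis
    unfolding sub1[OF uv(1)] sub1[OF uv(2)] sub2[OF uv(1)] sub2[OF uv(2)] same_facial_walk_subwalk1
    by (simp add: genus_diff_def genus_def euler_char_def field_simps)
qed

end

subsection \<open>From the operation phi to a pair of cuts\<close>

text \<open>Read the cycle from the start of the consecutive run. The inherited rotation always
  moves to the next element of \<open>A \<union> B\<close>, so the run ends before the first element
  of \<open>B\<close>, and all of \<open>A\<close> precedes \<open>B\<close> in this turn.\<close>

lemma consecutive_enumeration:
  assumes perm: "permutation f" and cyc: "cyclic_on f w"
    and AB: "A \<union> B \<subseteq> w" "A \<inter> B = {}" "A \<noteq> {}" "B \<noteq> {}"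
    and con: "consecutive (inherited_rotation f (A \<union> B)) A"
  obtains a m h l N where "(f ^^ N) a = a" "w = (\<lambda>k. (f ^^ k) a) ` {..<N}"
    "m < h" "h \<le> l" "l < N" "a \<in> A" "(f ^^ m) a \<in> A" "(f ^^ h) a \<in> B" "(f ^^ l) a \<in> B"
    "\<And>k. k < N \<Longrightarrow> (f ^^ k) a \<in> A \<Longrightarrow> k \<le> m"
    "\<And>k. k < N \<Longrightarrow> (f ^^ k) a \<in> B \<Longrightarrow> h \<le> k \<and> k \<le> l"
proof -
  define \<rho> where "\<rho> = inherited_rotation f (A \<union> B)"
  obtain a n where A: "A = {(\<rho> ^^ k) a | k. k < n}" using con unfolding \<rho>_def[symmetric] by (auto simp: consecutive_def)
  have "0 < n" using A AB(3) by auto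
  then have a: "a \<in> A" unfolding A by (intro CollectI exI[of _ 0]) simp
  define N where "N = (LEAST N. 0 < N \<and> (f ^^ N) a = a)"
  have "\<exists>N. 0 < N \<and> (f ^^ N) a = a"
    using permutation_self_in_orbit[OF perm, of a] by (auto simp: orbit_altdef)
  then have N: "0 < N" "(f ^^ N) a = a" unfolding N_def by (metis (mono_tags, lifting) LeastI_ex)+
  have min: "(f ^^ k) a \<noteq> a" if "0 < k" "k < N" for k
    using not_less_Least[of k "\<lambda>N. 0 < N \<and> (f ^^ N) a = a"] that unfolding N_def by auto
  have inj: "inj_on (\<lambda>k. (f ^^ k) a) {0..<N}"
    by (rule inj_on_funpow_least[OF N(2)]) (use min in auto)
  have w: "w = (\<lambda>k. (f ^^ k) a) ` {..<N}"
    using orbit_cyclic_eq3[OF cyc, of a] a AB(1) orbit_altdef_bounded[OF N(2,1)] by auto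
  define h where "h = (LEAST k. (f ^^ k) a \<in> B)"
  obtain k0 where k0: "k0 < N" "(f ^^ k0) a \<in> B" using AB(1,4) w by blast
  have h: "(f ^^ h) a \<in> B" unfolding h_def by (rule LeastI[of _ k0]) (rule k0)
  have h_le: "h \<le> k" if "(f ^^ k) a \<in> B" for k unfolding h_def using that by (rule Least_le)
  have hN: "h < N" using h_le[OF k0(2)] k0(1) by simp
  have "0 < h" using h a AB(2) by (cases h) auto
  \<comment> \<open>Iterating the inherited rotation from \<open>a\<close> cannot leave \<open>A\<close>, so it cannot jump over \<open>h\<close>.\<close>
  have low: "\<exists>j < h. (\<rho> ^^ i) a = (f ^^ j) a" if "i < n" for i
    using that
  proof (induction i)
    case 0
    then show ?case using \<open>0 < h\<close> by auto
  next
    case (Suc i)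
    then obtain j where j: "j < h" "(\<rho> ^^ i) a = (f ^^ j) a" by auto
    let ?P = "\<lambda>d. 0 < d \<and> (f ^^ d) ((f ^^ j) a) \<in> A \<union> B"
    have add: "(f ^^ d) ((f ^^ j) a) = (f ^^ (j + d)) a" for d
      by (simp add: funpow_add add.commute[of j])
    have "?P (h - j)" using j h unfolding add by simp
    then have "(LEAST d. ?P d) \<le> h - j" by (rule Least_le)
    moreover define d where "d = (LEAST d. ?P d)"
    ultimately have d: "j + d \<le> h" using j by simp
    have "(\<rho> ^^ Suc i) a = \<rho> ((f ^^ j) a)" by (simp add: j(2))
    also have "\<dots> = (f ^^ d) ((f ^^ j) a)" unfolding \<rho>_def inherited_rotation_def d_def ..
    finally have eq: "(\<rho> ^^ Suc i) a = (f ^^ (j + d)) a" unfolding add .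
    moreover have "(\<rho> ^^ Suc i) a \<in> A" unfolding A using Suc.prems by blast
    ultimately have "j + d \<noteq> h" using h AB(2) by auto
    then show ?case using d eq by (intro exI[of _ "j + d"]) simp
  qed
  have A_low: "k < h" if k: "k < N" "(f ^^ k) a \<in> A" for k
  proof -
    obtain i where "i < n" "(f ^^ k) a = (\<rho> ^^ i) a" using k(2) A by blast
    then obtain j where "j < h" "(f ^^ k) a = (f ^^ j) a" using low by metis
    then show ?thesis using inj_onD[OF inj, of k j] k hN by simp
  qed
  let ?MA = "{k. k < N \<and> (f ^^ k) a \<in> A}" and ?MB = "{k. k < N \<and> (f ^^ k) a \<in> B}"
  have "0 \<in> ?MA" using a N by simp
  then have MA: "Max ?MA \<in> ?MA" by (intro Max_in) auto
  have "h \<in> ?MB" using h hN by simp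
  then have MB: "Max ?MB \<in> ?MB" "h \<le> Max ?MB" by (intro Max_in Max_ge; auto)+
  show thesis
  proof (rule that[of N a "Max ?MA" h "Max ?MB"])
    show "Max ?MA < h" using MA A_low by blast
    show "k \<le> Max ?MA" if "k < N" "(f ^^ k) a \<in> A" for k
      using that by (intro Max_ge) auto
    show "h \<le> k \<and> k \<le> Max ?MB" if "k < N" "(f ^^ k) a \<in> B" for k
      using that h_le by (auto intro!: Max_ge)
  qed (use N w a h MA MB in auto)
qed

section \<open>Zero-homologous subgraphs of the dual as cuts\<close>

context cubic_map
begin

text \<open>Arc reversal cancels when face tracing is applied to the dual rotation, which gives back
  the local rotations of \<open>G\<close>.\<close>

lemma face_of_dual:
  assumes "a \<in> arcs G"
  shows "face_of \<iota> \<phi> a = out_arcs G (tail G a)"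
proof -
  have "face_succ \<iota> \<phi> = \<sigma>\<^sub>0" by (simp add: fun_eq_iff face_succ_def)
  then show ?thesis
    unfolding face_of_def using assms by (simp add: orbit_cyclic_eq3[OF cyclic_out_arcs[OF rotation]])
qed

text \<open>Faces of the dual are vertices of \<open>G\<close>, so a set of them is a vertex set,
  and an edge survives mod 2 exactly when one of its ends lies in it.\<close>

lemma zero_homologous_cut:
  assumes "zero_homologous (dual G \<iota> \<sigma>\<^sub>0) \<iota> \<phi> H"
  obtains Y where "arcs H = cut G Y"
proof -
  obtain S where S: "S \<subseteq> faces (dual G \<iota> \<sigma>\<^sub>0) \<iota> \<phi>"
    "arcs H = {a \<in> arcs G. odd (card {F \<in> S. (a \<in> F) \<noteq> (\<iota> a \<in> F)})}"
    using assms by (auto simp: zero_homologous_def dual_def)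
  have vert: "\<exists>x. F = out_arcs G x" if "F \<in> S" for F
    using that S(1) by (auto simp: faces_def dual_def face_of_dual)
  let ?Y = "\<lambda>x. out_arcs G x \<in> S"
  have "odd (card {F \<in> S. (a \<in> F) \<noteq> (\<iota> a \<in> F)}) \<longleftrightarrow> ?Y (tail G a) \<noteq> ?Y (head G a)"
    if a: "a \<in> arcs G" for a
  proof (cases "tail G a = head G a")
    case True
    \<comment> \<open>A loop is traversed in both directions by the same dual face and
      cancels.\<close>
    then have "{F \<in> S. (a \<in> F) \<noteq> (\<iota> a \<in> F)} = {}" using a vert by fastforce
    then show ?thesis using True by (simp only: card.empty) simp
  next
    case False
    then have "{F \<in> S. (a \<in> F) \<noteq> (\<iota> a \<in> F)} = {F \<in> S. F = out_arcs G (tail G a) \<or> F = out_arcs G (head G a)}"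
      using a vert by fastforce
    also have "\<dots> = (if ?Y (tail G a) then {out_arcs G (tail G a)} else {})
        \<union> (if ?Y (head G a) then {out_arcs G (head G a)} else {})" by auto
    finally have "{F \<in> S. (a \<in> F) \<noteq> (\<iota> a \<in> F)} = (if ?Y (tail G a) then {out_arcs G (tail G a)} else {})
        \<union> (if ?Y (head G a) then {out_arcs G (head G a)} else {})" .
    moreover have "out_arcs G (tail G a) \<noteq> out_arcs G (head G a)" using a False by (metis in_out_arcs_conv)
    ultimately show ?thesis by simp
  qed
  then have "arcs H = cut G ?Y" using S(2) by (auto simp: cut_def)
  then show thesis by (rule that)
qed

text \<open>A subgraph of the dual without isolated vertices is determined by its arcs.\<close>

lemma unstable_dual_flip:
  assumes H: "subgraph H (dual G \<iota> \<sigma>\<^sub>0)" and arcs: "arcs H = cut G Y"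
    and verts: "\<And>w. w \<in> verts H \<Longrightarrow> w \<inter> cut G Y \<noteq> {}"
  shows "unstable_dual G \<iota> \<sigma>\<^sub>0 (flip G \<sigma>\<^sub>0 Y) = H"
proof -
  have th: "tail H = base_face" "head H = (\<lambda>a. base_face (\<iota> a))" and vf: "verts H \<subseteq> faces G \<iota> \<sigma>\<^sub>0"
    and wf: "wf_digraph H"
    using H by (auto simp: subgraph_def compatible_def dual_def)
  have "unstable_faces G \<iota> \<sigma>\<^sub>0 (flip G \<sigma>\<^sub>0 Y) = verts H"
  proof
    show "verts H \<subseteq> unstable_faces G \<iota> \<sigma>\<^sub>0 (flip G \<sigma>\<^sub>0 Y)"
      using vf verts by (auto simp: unstable_faces_def unstable_arcs_flip)
    show "unstable_faces G \<iota> \<sigma>\<^sub>0 (flip G \<sigma>\<^sub>0 Y) \<subseteq> verts H"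
    proof
      fix F assume "F \<in> unstable_faces G \<iota> \<sigma>\<^sub>0 (flip G \<sigma>\<^sub>0 Y)"
      then obtain a b where "F = base_face a" "b \<in> F" "b \<in> cut G Y"
        by (auto simp: unstable_faces_def unstable_arcs_flip faces_def)
      then have "F = tail H b" "b \<in> arcs H" using base_face_eq_iff[of b a] th arcs by auto
      then show "F \<in> verts H" using wf by (simp add: wf_digraph.tail_in_verts)
    qed
  qed
  then show ?thesis
    using th arcs
    by (intro pre_digraph.equality) (simp_all add: unstable_dual_def unstable_arcs_flip dual_def)
qed

end

theorem theorem4p6:
  fixes G :: "('a, 'b) pre_digraph"
    and \<iota> \<sigma>\<^sub>0 \<sigma> :: "'b \<Rightarrow> 'b"
    and G\<^sub>1 G\<^sub>2 :: "('b set, 'b) pre_digraph"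
    and u v :: "'b set"
  assumes "fin_digraph G" and "bidirected_digraph G \<iota>" and "connected G" and "cubic G"
    and "rotation_system G \<sigma>\<^sub>0" and "rotation_system G \<sigma>"
    and "is_phi (dual G \<iota> \<sigma>\<^sub>0) \<iota> (face_succ \<iota> \<sigma>\<^sub>0) (unstable_dual G \<iota> \<sigma>\<^sub>0 \<sigma>) G\<^sub>1 G\<^sub>2 u v"
  shows "\<exists>\<sigma>\<^sub>1 \<sigma>\<^sub>2.
     rotation_system G \<sigma>\<^sub>1 \<and> rotation_system G \<sigma>\<^sub>2 \<and>
     unstable_dual G \<iota> \<sigma>\<^sub>0 \<sigma>\<^sub>1 = G\<^sub>1 \<and> unstable_dual G \<iota> \<sigma>\<^sub>0 \<sigma>\<^sub>2 = G\<^sub>2 \<and>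
     (let U\<^sub>1 = subwalk_containing G \<iota> \<sigma>\<^sub>0 \<sigma>\<^sub>1 u (out_arcs G\<^sub>2 u);
          V\<^sub>1 = subwalk_containing G \<iota> \<sigma>\<^sub>0 \<sigma>\<^sub>1 v (out_arcs G\<^sub>2 v);
          U\<^sub>2 = subwalk_containing G \<iota> \<sigma>\<^sub>0 \<sigma>\<^sub>2 u (out_arcs G\<^sub>1 u);
          V\<^sub>2 = subwalk_containing G \<iota> \<sigma>\<^sub>0 \<sigma>\<^sub>2 v (out_arcs G\<^sub>1 v)
      in genus_diff G \<iota> \<sigma>\<^sub>0 \<sigma> = genus_diff G \<iota> \<sigma>\<^sub>0 \<sigma>\<^sub>1 + genus_diff G \<iota> \<sigma>\<^sub>0 \<sigma>\<^sub>2
           - same_facial_walk G \<iota> \<sigma>\<^sub>1 U\<^sub>1 V\<^sub>1 * same_facial_walk G \<iota> \<sigma>\<^sub>2 U\<^sub>2 V\<^sub>2)"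
proof -
  interpret cubic_map G \<iota> \<sigma>\<^sub>0
    using assms(1,2,4,5)
    by (simp add: cubic_map_def cubic_map_axioms_def)
  let ?D = "dual G \<iota> \<sigma>\<^sub>0" and ?H = "unstable_dual G \<iota> \<sigma>\<^sub>0 \<sigma>"
  have sub: "subgraph G\<^sub>1 ?D" "subgraph G\<^sub>2 ?D" and zero: "zero_homologous ?D \<iota> \<phi> G\<^sub>2"
    and H: "?H = union G\<^sub>1 G\<^sub>2" and uv: "u \<noteq> v" "verts G\<^sub>1 \<inter> verts G\<^sub>2 = {u, v}"
    and disj: "arcs G\<^sub>1 \<inter> arcs G\<^sub>2 = {}"
    and out: "\<And>w. w \<in> {u, v} \<Longrightarrow> out_arcs G\<^sub>1 w \<noteq> {} \<and> out_arcs G\<^sub>2 w \<noteq> {} \<and>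
      consecutive (inherited_rotation \<phi> (out_arcs ?H w)) (out_arcs G\<^sub>1 w)"
    using assms(7) unfolding is_phi_def by blast+
  have t: "tail G\<^sub>1 = base_face" "tail G\<^sub>2 = base_face" and vf: "verts G\<^sub>1 \<subseteq> faces G \<iota> \<sigma>\<^sub>0" "verts G\<^sub>2 \<subseteq> faces G \<iota> \<sigma>\<^sub>0"
    and wf: "wf_digraph G\<^sub>1" "wf_digraph G\<^sub>2"
    using sub by (auto simp: subgraph_def compatible_def dual_def)
  define X where "X = unstable_vert G \<sigma>\<^sub>0 \<sigma>"
  obtain X2 where X2: "arcs G\<^sub>2 = cut G X2" using zero_homologous_cut[OF zero] .
  define X1 where "X1 x \<longleftrightarrow> X x \<noteq> X2 x" for x
  have X_eq: "(\<lambda>x. X1 x \<noteq> X2 x) = X" by (auto simp: X1_def)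
  have arcs_H: "arcs ?H = cut G X"
    by (auto simp: unstable_dual_def unstable_arcs_def cut_def X_def)
  then have "cut G X = arcs G\<^sub>1 \<union> arcs G\<^sub>2" using H by (simp add: union_def)
  then have X1: "arcs G\<^sub>1 = cut G X1"
    using disj unfolding X2 by (auto simp: cut_def X1_def)
  have \<sigma>: "flip G \<sigma>\<^sub>0 X = \<sigma>" unfolding X_def by (rule flip_unstable_vert[OF assms(6)])
  have face: "base_face a = w \<longleftrightarrow> a \<in> w" if "w \<in> faces G \<iota> \<sigma>\<^sub>0" for a w
    using that base_face_eq_iff by (auto simp: faces_def)
  have o1: "out_arcs G\<^sub>1 w = w \<inter> cut G X1" and o2: "out_arcs G\<^sub>2 w = w \<inter> cut G X2"
    if "w \<in> faces G \<iota> \<sigma>\<^sub>0" for w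
    using face[OF that] t X1 X2 by auto
  \<comment> \<open>Every vertex is an unstable face and meets one of the cuts. If it meets the cut
    of the other graph it is a common vertex, so \<open>u\<close> or \<open>v\<close>, where both
    cuts are met; hence neither graph has isolated vertices.\<close>
  have verts_H: "w \<inter> (cut G X1 \<union> cut G X2) \<noteq> {}" if "w \<in> verts G\<^sub>1 \<union> verts G\<^sub>2" for w
  proof -
    have "w \<in> verts ?H" using that H by (simp add: union_def)
    then have "w \<inter> unstable_arcs G \<sigma>\<^sub>0 \<sigma> \<noteq> {}" by (auto simp: unstable_dual_def unstable_faces_def)
    moreover have "unstable_arcs G \<sigma>\<^sub>0 \<sigma> = cut G X1 \<union> cut G X2"
      using arcs_H H X1 X2 by (simp add: unstable_dual_def union_def)
    ultimately show ?thesis by simp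
  qed
  have in_verts: "w \<in> verts G\<^sub>1" if "w \<in> faces G \<iota> \<sigma>\<^sub>0" "w \<inter> cut G X1 \<noteq> {}" for w
    using that o1[OF that(1)] wf(1) by (metis ex_in_conv in_out_arcs_conv wf_digraph.tail_in_verts)
  have in_verts2: "w \<in> verts G\<^sub>2" if "w \<in> faces G \<iota> \<sigma>\<^sub>0" "w \<inter> cut G X2 \<noteq> {}" for w
    using that o2[OF that(1)] wf(2) by (metis ex_in_conv in_out_arcs_conv wf_digraph.tail_in_verts)
  have uvf: "w \<in> faces G \<iota> \<sigma>\<^sub>0" if "w \<in> {u, v}" for w using that uv(2) vf by blast
  have meet: "w \<inter> cut G X1 \<noteq> {}" "w \<inter> cut G X2 \<noteq> {}" if "w \<in> {u, v}" for w
    using out[OF that] o1[OF uvf[OF that]] o2[OF uvf[OF that]] by auto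
  have G1: "unstable_dual G \<iota> \<sigma>\<^sub>0 (flip G \<sigma>\<^sub>0 X1) = G\<^sub>1"
  proof (rule unstable_dual_flip[OF sub(1) X1])
    fix w assume w: "w \<in> verts G\<^sub>1"
    show "w \<inter> cut G X1 \<noteq> {}"
    proof (cases "w \<inter> cut G X2 = {}")
      case True
      then show ?thesis using verts_H[of w] w by blast
    next
      case False
      then have "w \<in> {u, v}" using in_verts2 w vf(1) uv(2) by blast
      then show ?thesis by (rule meet)
    qed
  qed
  have G2: "unstable_dual G \<iota> \<sigma>\<^sub>0 (flip G \<sigma>\<^sub>0 X2) = G\<^sub>2"
  proof (rule unstable_dual_flip[OF sub(2) X2])
    fix w assume w: "w \<in> verts G\<^sub>2"
    show "w \<inter> cut G X2 \<noteq> {}"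
    proof (cases "w \<inter> cut G X1 = {}")
      case True
      then show ?thesis using verts_H[of w] w by blast
    next
      case False
      then have "w \<in> {u, v}" using in_verts w vf(2) uv(2) by blast
      then show ?thesis by (rule meet)
    qed
  qed
  \<comment> \<open>All data of one face in a single predicate, so that one choice yields them as
    functions of the face.\<close>
  define P where "P w a m h l N \<longleftrightarrow> (\<phi> ^^ N) a = a \<and> w = (\<lambda>k. (\<phi> ^^ k) a) ` {..<N} \<and>
      (m < h \<and> h \<le> l \<and> l < N) \<and> (a \<in> cut G X1 \<and> (\<phi> ^^ m) a \<in> cut G X1) \<and>
      ((\<phi> ^^ h) a \<in> cut G X2 \<and> (\<phi> ^^ l) a \<in> cut G X2) \<and>
      (\<forall>k < N. (\<phi> ^^ k) a \<in> cut G X1 \<longrightarrow> k \<le> m) \<and>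
      (\<forall>k < N. (\<phi> ^^ k) a \<in> cut G X2 \<longrightarrow> h \<le> k \<and> k \<le> l)" for w a m h l N
  have "\<exists>a m h l N. P w a m h l N" if w: "w \<in> {u, v}" for w
  proof -
    let ?A = "w \<inter> cut G X1" and ?B = "w \<inter> cut G X2"
    have perm: "permutation \<phi>" by (rule permutation_face_succ[OF rotation])
    have "out_arcs ?H w = out_arcs G\<^sub>1 w \<union> out_arcs G\<^sub>2 w"
      using t unfolding H by (auto simp: union_def)
    then have "out_arcs ?H w = ?A \<union> ?B" by (simp only: o1 o2 uvf[OF w])
    then have con: "consecutive (inherited_rotation \<phi> (?A \<union> ?B)) ?A"
      using out[OF w] o1[OF uvf[OF w]] by simp
    obtain c where "w = orbit \<phi> c" using uvf[OF w] by (auto simp: faces_def face_of_def)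
    then have cyc: "cyclic_on \<phi> w" using cyclic_on_orbit'[OF perm] by simp
    have AB: "?A \<union> ?B \<subseteq> w" "?A \<inter> ?B = {}" using disj X1 X2 by blast+
    show ?thesis
    proof (rule consecutive_enumeration[OF perm cyc AB meet[OF w] con])
      fix a m h l N
      assume *: "(\<phi> ^^ N) a = a" "w = (\<lambda>k. (\<phi> ^^ k) a) ` {..<N}"
        "m < h" "h \<le> l" "l < N" "a \<in> ?A" "(\<phi> ^^ m) a \<in> ?A" "(\<phi> ^^ h) a \<in> ?B" "(\<phi> ^^ l) a \<in> ?B"
        "\<And>k. k < N \<Longrightarrow> (\<phi> ^^ k) a \<in> ?A \<Longrightarrow> k \<le> m"
        "\<And>k. k < N \<Longrightarrow> (\<phi> ^^ k) a \<in> ?B \<Longrightarrow> h \<le> k \<and> k \<le> l"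
      have "(\<phi> ^^ k) a \<in> w" for k using cyclic_on_funpow_in[OF cyc] *(6) by simp
      then have "P w a m h l N" unfolding P_def using *(1,3-) *(2)[symmetric] by simp
      then show ?thesis by blast
    qed
  qed
  then obtain a m h l N where P: "\<And>w. w \<in> {u, v} \<Longrightarrow> P w (a w) (m w) (h w) (l w) (N w)"
    by metis
  interpret cubic_phi G \<iota> \<sigma>\<^sub>0 X1 X2 u v "\<lambda>w k. (\<phi> ^^ k) (a w)" m h l N
  proof unfold_locales
    show "cut G X1 \<inter> cut G X2 = {}" using disj X1 X2 by simp
    show "u \<noteq> v" by (rule uv)
    \<comment> \<open>Such a face carries arcs of both graphs and is therefore a common
      vertex.\<close>
    fix b c assume bc: "b \<in> cut G X1" "c \<in> cut G X2" "base_face b = base_face c"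
    then have "base_face b \<in> faces G \<iota> \<sigma>\<^sub>0" "b \<in> base_face b" "c \<in> base_face b"
      using cut_arc self_in_base_face by (auto simp: faces_def)
    then show "base_face b \<in> {u, v}"
      using in_verts[of "base_face b"] in_verts2[of "base_face b"] bc uv(2) by blast
  next
    fix w assume w: "w \<in> {u, v}"
    show "w = base_face ((\<phi> ^^ 0) (a w))"
    proof -
      have "a w \<in> w" using P[OF w] by (auto simp: P_def intro!: image_eqI[of _ _ 0])
      then have "base_face (a w) = w" using face[OF uvf[OF w]] by simp
      then show ?thesis by simp
    qed
  qed (use P in \<open>auto simp: P_def\<close>)
  show ?thesis
    using genus_diff_phi rotation_system_flip[of X1] rotation_system_flip[of X2] G1 G2
    unfolding X_eq \<sigma>
    by (intro exI[of _ "flip G \<sigma>\<^sub>0 X1"] exI[of _ "flip G \<sigma>\<^sub>0 X2"]) (simp add: Let_def o1 o2 uvf)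
qed

end
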